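(* $\mathsf{ZF}$ is solid.
   Context: A set is $\mathcal{M}$-definable iff it is definable in $\mathcal{M}$ by a first order formula with parameters from $M$; $\mathcal{M}\trianglerighteq_{\mathrm{par}}\mathcal{N}$ means the universe of $\mathcal{N}$ and the interpretations in $\mathcal{N}$ of all predicates of its language are $\mathcal{M}$-definable. A first order theory $T$ is solid iff for all models $\mathcal{M},\mathcal{M}^*,\mathcal{N}$ of $T$: if $\mathcal{M}\trianglerighteq_{\mathrm{par}}\mathcal{N}\trianglerighteq_{\mathrm{par}}\mathcal{M}^*$ and there is an $\mathcal{M}$-definable isomorphism $i_0:\mathcal{M}\to\mathcal{M}^*$, then there is an $\mathcal{M}$-definable isomorphism $i:\mathcal{M}\to\mathcal{N}$. *)

theory Defs
  imports Main "HOL-Library.NList"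
begin

section \<open>First-order logic with equality over a relational language\<close>

text \<open>
  A language is given by a type \<open>'p\<close> of predicate symbols and an arity function
  \<open>ar :: 'p \<Rightarrow> nat\<close>.  Variables are natural numbers.
\<close>

datatype 'p form =
    Eq nat nat
  | Atom 'p "nat list"
  | Neg "'p form"
  | Conj "'p form" "'p form"
  | Exists nat "'p form"

abbreviation Imp :: "'p form \<Rightarrow> 'p form \<Rightarrow> 'p form" where
  "Imp \<phi> \<psi> \<equiv> Neg (Conj \<phi> (Neg \<psi>))"

abbreviation Disj :: "'p form \<Rightarrow> 'p form \<Rightarrow> 'p form" where
  "Disj \<phi> \<psi> \<equiv> Neg (Conj (Neg \<phi>) (Neg \<psi>))"

abbreviation Iff :: "'p form \<Rightarrow> 'p form \<Rightarrow> 'p form" where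
  "Iff \<phi> \<psi> \<equiv> Conj (Imp \<phi> \<psi>) (Imp \<psi> \<phi>)"

abbreviation Forall :: "nat \<Rightarrow> 'p form \<Rightarrow> 'p form" where
  "Forall x \<phi> \<equiv> Neg (Exists x (Neg \<phi>))"

primrec fv :: "'p form \<Rightarrow> nat set" where
  "fv (Eq x y) = {x, y}"
| "fv (Atom P xs) = set xs"
| "fv (Neg \<phi>) = fv \<phi>"
| "fv (Conj \<phi> \<psi>) = fv \<phi> \<union> fv \<psi>"
| "fv (Exists x \<phi>) = fv \<phi> - {x}"

record ('p, 'a) struc =
  univ :: "'a set"
  rel :: "'p \<Rightarrow> 'a list set"

text \<open>
  Here \<open>nlists n A\<close> is the set of \<open>n\<close>-tuples over \<open>A\<close>, as lists of length \<open>n\<close>.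
\<close>

definition is_struc :: "('p \<Rightarrow> nat) \<Rightarrow> ('p, 'a) struc \<Rightarrow> bool" where
  "is_struc ar M \<longleftrightarrow> univ M \<noteq> {} \<and> (\<forall>P. rel M P \<subseteq> nlists (ar P) (univ M))"

text \<open>
  Atoms with the wrong number of arguments are not excluded syntactically.  In every structure
  in the sense of \<open>is_struc\<close> they are false, so they affect neither the definable sets nor
  the strength of an axiom scheme.
\<close>

primrec sat :: "('p, 'a) struc \<Rightarrow> (nat \<Rightarrow> 'a) \<Rightarrow> 'p form \<Rightarrow> bool" where
  "sat M e (Eq x y) \<longleftrightarrow> e x = e y"
| "sat M e (Atom P xs) \<longleftrightarrow> map e xs \<in> rel M P"
| "sat M e (Neg \<phi>) \<longleftrightarrow> \<not> sat M e \<phi>"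
| "sat M e (Conj \<phi> \<psi>) \<longleftrightarrow> sat M e \<phi> \<and> sat M e \<psi>"
| "sat M e (Exists x \<phi>) \<longleftrightarrow> (\<exists>a\<in>univ M. sat M (e(x := a)) \<phi>)"

text \<open>
  Axioms may have free variables; they stand for their universal closures.
\<close>

definition models :: "('p \<Rightarrow> nat) \<Rightarrow> ('p, 'a) struc \<Rightarrow> 'p form set \<Rightarrow> bool" where
  "models ar M T \<longleftrightarrow>
     is_struc ar M \<and> (\<forall>\<phi>\<in>T. \<forall>e. range e \<subseteq> univ M \<longrightarrow> sat M e \<phi>)"


section \<open>Definability with parameters, interpretations, solidity\<close>

text \<open>
  \<open>X\<close> is a subset of \<open>(univ M)\<^sup>n\<close> defined by \<open>\<phi>\<close>, where the variables \<open>0, \<dots>, n - 1\<close> range over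
  the tuple and the remaining (finitely many) free variables of \<open>\<phi>\<close> are assigned parameters
  by \<open>e\<close>.
\<close>

definition definable :: "('p, 'a) struc \<Rightarrow> 'a list set \<Rightarrow> bool" where
  "definable M X \<longleftrightarrow>
     (\<exists>n \<phi> e. range e \<subseteq> univ M \<and>
        X = {xs \<in> nlists n (univ M). sat M (\<lambda>i. if i < n then xs ! i else e i) \<phi>})"

text \<open>
  A definable set may consist of tuples of any length \<open>k\<close>, so the elements of a structure
  interpreted in \<open>M\<close> are lists over \<open>univ M\<close>; one-dimensional interpretations are the case of
  singleton lists.  An \<open>m\<close>-ary relation on a set of \<open>k\<close>-tuples is regarded as a set of
  \<open>m * k\<close>-tuples via \<open>concat\<close>, which is injective on lists of \<open>k\<close>-tuples of a fixed length.
\<close>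

definition interprets :: "('p, 'a) struc \<Rightarrow> ('q, 'a list) struc \<Rightarrow> bool"
    (infix \<open>\<unrhd>\<^sub>p\<^sub>a\<^sub>r\<close> 50) where
  "M \<unrhd>\<^sub>p\<^sub>a\<^sub>r N \<longleftrightarrow> definable M (univ N) \<and> (\<forall>P. definable M (concat ` rel N P))"

definition isomorphism ::
    "('p \<Rightarrow> nat) \<Rightarrow> ('p, 'a) struc \<Rightarrow> ('p, 'b) struc \<Rightarrow> ('a \<Rightarrow> 'b) \<Rightarrow> bool" where
  "isomorphism ar M N f \<longleftrightarrow>
     bij_betw f (univ M) (univ N) \<and>
     (\<forall>P. \<forall>xs \<in> nlists (ar P) (univ M). xs \<in> rel M P \<longleftrightarrow> map f xs \<in> rel N P)"

text \<open>
  In \<open>M \<unrhd>\<^sub>p\<^sub>a\<^sub>r N \<unrhd>\<^sub>p\<^sub>a\<^sub>r M'\<close> the elements of \<open>M'\<close> are tuples of elements of \<open>N\<close>, that is, tuples of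
  tuples of elements of \<open>M\<close>; they are flattened to express that the graph of \<open>i0\<close> is
  \<open>M\<close>-definable.  A HOL definition cannot quantify over types, hence the type argument:
  \<open>M\<close> ranges over the models whose universe is a set of elements of type \<open>'a\<close>.
\<close>

definition solid :: "'a itself \<Rightarrow> ('p \<Rightarrow> nat) \<Rightarrow> 'p form set \<Rightarrow> bool" where
  "solid _ ar T \<longleftrightarrow>
     (\<forall>(M :: ('p, 'a) struc) (M' :: ('p, 'a list list) struc) (N :: ('p, 'a list) struc).
        models ar M T \<and> models ar M' T \<and> models ar N T \<and>
        M \<unrhd>\<^sub>p\<^sub>a\<^sub>r N \<and> N \<unrhd>\<^sub>p\<^sub>a\<^sub>r M' \<and>
        (\<exists>i0. isomorphism ar M M' i0 \<and> definable M ((\<lambda>x. x # concat (i0 x)) ` univ M))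
        \<longrightarrow> (\<exists>i. isomorphism ar M N i \<and> definable M ((\<lambda>x. x # i x) ` univ M)))"


section \<open>The axioms of ZF\<close>

datatype set_pred = Mem

definition set_ar :: "set_pred \<Rightarrow> nat" where
  "set_ar P = 2"

abbreviation mem :: "nat \<Rightarrow> nat \<Rightarrow> set_pred form" (infix \<open>\<epsilon>\<close> 60) where
  "x \<epsilon> y \<equiv> Atom Mem [x, y]"

definition extensionality_ax :: "set_pred form" where
  "extensionality_ax = Forall 0 (Forall 1 (Imp (Forall 2 (Iff (2 \<epsilon> 0) (2 \<epsilon> 1))) (Eq 0 1)))"

definition foundation_ax :: "set_pred form" where
  "foundation_ax =
     Forall 0 (Imp (Exists 1 (1 \<epsilon> 0)) (Exists 1 (Conj (1 \<epsilon> 0) (Forall 2 (Imp (2 \<epsilon> 0) (Neg (2 \<epsilon> 1)))))))"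

definition pairing_ax :: "set_pred form" where
  "pairing_ax = Forall 0 (Forall 1 (Exists 2 (Forall 3 (Iff (3 \<epsilon> 2) (Disj (Eq 3 0) (Eq 3 1))))))"

definition union_ax :: "set_pred form" where
  "union_ax = Forall 0 (Exists 1 (Forall 2 (Iff (2 \<epsilon> 1) (Exists 3 (Conj (3 \<epsilon> 0) (2 \<epsilon> 3))))))"

definition powerset_ax :: "set_pred form" where
  "powerset_ax = Forall 0 (Exists 1 (Forall 2 (Iff (2 \<epsilon> 1) (Forall 3 (Imp (3 \<epsilon> 2) (3 \<epsilon> 0))))))"

text \<open>
  There is a set that contains an empty set and is closed under \<open>x \<mapsto> x \<union> {x}\<close>.
\<close>

definition infinity_ax :: "set_pred form" where
  "infinity_ax =
     Exists 0 (Conj (Exists 1 (Conj (1 \<epsilon> 0) (Forall 2 (Neg (2 \<epsilon> 1)))))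
                 (Forall 1 (Imp (1 \<epsilon> 0)
                    (Exists 2 (Conj (2 \<epsilon> 0) (Forall 3 (Iff (3 \<epsilon> 2) (Disj (3 \<epsilon> 1) (Eq 3 1)))))))))"

text \<open>
  In the two schemes all further free variables of \<open>\<phi>\<close> act as parameters.
\<close>

definition separation :: "nat \<Rightarrow> nat \<Rightarrow> nat \<Rightarrow> set_pred form \<Rightarrow> set_pred form" where
  "separation x y z \<phi> = Forall z (Exists y (Forall x (Iff (x \<epsilon> y) (Conj (x \<epsilon> z) \<phi>))))"

text \<open>
  \<open>Exists1 w y \<phi>\<close> expresses \<open>\<exists>!y. \<phi>\<close>, provided \<open>w\<close> is not free in \<open>\<phi>\<close> and different from \<open>y\<close>.
\<close>

definition Exists1 :: "nat \<Rightarrow> nat \<Rightarrow> 'p form \<Rightarrow> 'p form" where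
  "Exists1 w y \<phi> = Exists w (Forall y (Iff \<phi> (Eq y w)))"

definition replacement ::
    "nat \<Rightarrow> nat \<Rightarrow> nat \<Rightarrow> nat \<Rightarrow> nat \<Rightarrow> set_pred form \<Rightarrow> set_pred form" where
  "replacement a b x y w \<phi> =
     Forall a (Imp (Forall x (Imp (x \<epsilon> a) (Exists1 w y \<phi>)))
                (Exists b (Forall x (Imp (x \<epsilon> a) (Exists y (Conj (y \<epsilon> b) \<phi>))))))"

definition ZF :: "set_pred form set" where
  "ZF =
     {extensionality_ax, foundation_ax, pairing_ax, union_ax, powerset_ax, infinity_ax} \<union>
     {separation x y z \<phi> | x y z \<phi>. distinct [x, y, z] \<and> y \<notin> fv \<phi>} \<union>
     {replacement a b x y w \<phi> | a b x y w \<phi>.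
        distinct [a, b, x, y, w] \<and> b \<notin> fv \<phi> \<and> w \<notin> fv \<phi>}"

end

theory Submission
  imports Defs
begin

text \<open>
  Replace \<open>N\<close> and \<open>M'\<close> by copies on elements of \<open>M\<close>, coding tuples by iterated Kuratowski pairs,
  so that \<open>P \<subseteq> N \<subseteq> M\<close> with an \<open>M\<close>-definable isomorphism \<open>i\<close> from \<open>M\<close> to the copy \<open>P\<close> of \<open>M'\<close>.

  A model \<open>K\<close> can build the cumulative hierarchy of a definable model \<open>L\<close> along its own membership,
  as a partial function \<open>F\<close> from \<open>K\<close> to levels of \<open>L\<close>; this replaces the comparison of the ordinals
  of \<open>K\<close> and \<open>L\<close>.  If \<open>L\<close> is well-founded for \<open>K\<close>-definable classes and \<open>F\<close> is not total, its values are
  cofinal in \<open>L\<close>, and the inverse Mostowski collapse \<open>T\<close> maps a set of \<open>K\<close> onto \<open>L\<close>.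
  For \<open>N\<close> and \<open>P\<close> this is excluded by diagonalisation: all \<open>M\<close>-definable classes would be coded by
  elements of \<open>N\<close>.  Hence \<open>F\<close> is total there, which makes \<open>N\<close> well-founded for \<open>M\<close>.  For \<open>M\<close> and \<open>N\<close> it is
  excluded because \<open>M\<close> would inject into one of its sets.  The composite of the two hierarchies with
  the inverse of \<open>i\<close> is a strictly increasing map from \<open>M\<close> to itself and therefore unbounded, so both
  hierarchies are cofinal and both maps \<open>T\<close> are surjective.  The composite of the latter with the
  inverse of \<open>i\<close> is the identity by induction, so \<open>T\<close> is an isomorphism from \<open>M\<close> to \<open>N\<close>.
\<close>

section \<open>Definable predicates\<close>

lemma sat_cong: "(\<And>x. x \<in> fv \<phi> \<Longrightarrow> e x = e' x) \<Longrightarrow> sat M e \<phi> = sat M e' \<phi>"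
proof (induction \<phi> arbitrary: e e')
  case (Atom P xs)
  then have "map e xs = map e' xs" by simp
  then show ?case by (simp only: sat.simps)
next
  case (Neg \<phi>)
  have "sat M e \<phi> = sat M e' \<phi>" by (rule Neg.IH) (simp add: Neg.prems)
  then show ?case by simp
next
  case (Conj \<phi> \<psi>)
  have "sat M e \<phi> = sat M e' \<phi>" by (rule Conj.IH(1)) (simp add: Conj.prems)
  moreover have "sat M e \<psi> = sat M e' \<psi>" by (rule Conj.IH(2)) (simp add: Conj.prems)
  ultimately show ?case by simp
next
  case (Exists x \<phi>)
  have "sat M (e(x := a)) \<phi> = sat M (e'(x := a)) \<phi>" for a
    by (rule Exists.IH) (simp add: Exists.prems)
  then show ?case by simp
qed simp

lemma finite_fv: "finite (fv \<phi>)"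
  by (induction \<phi>) auto

text \<open>Since \<open>f\<close> may identify variables, the bound variable is replaced by one
  outside the image of the free variables; this rules out capture.\<close>

lemma ex_rename: "\<exists>\<phi>'. fv \<phi>' \<subseteq> f ` fv \<phi> \<and> (\<forall>e. sat M e \<phi>' = sat M (\<lambda>i. e (f i)) \<phi>)"
proof (induction \<phi> arbitrary: f)
  case (Eq x y)
  show ?case by (rule exI[of _ "Eq (f x) (f y)"]) auto
next
  case (Atom P xs)
  show ?case by (rule exI[of _ "Atom P (map f xs)"]) (auto simp: comp_def)
next
  case (Neg \<phi>)
  then obtain \<phi>' where "fv \<phi>' \<subseteq> f ` fv \<phi> \<and> (\<forall>e. sat M e \<phi>' = sat M (\<lambda>i. e (f i)) \<phi>)" by blast
  then show ?case by (intro exI[of _ "Neg \<phi>'"]) auto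
next
  case (Conj \<phi> \<psi>)
  obtain \<phi>' where "fv \<phi>' \<subseteq> f ` fv \<phi> \<and> (\<forall>e. sat M e \<phi>' = sat M (\<lambda>i. e (f i)) \<phi>)"
    using Conj.IH(1) by blast
  moreover obtain \<psi>' where "fv \<psi>' \<subseteq> f ` fv \<psi> \<and> (\<forall>e. sat M e \<psi>' = sat M (\<lambda>i. e (f i)) \<psi>)"
    using Conj.IH(2) by blast
  ultimately show ?case by (intro exI[of _ "Conj \<phi>' \<psi>'"]) auto
next
  case (Exists x \<phi>)
  obtain y where y: "y \<notin> f ` fv \<phi>"
    using finite_fv ex_new_if_finite[of "f ` fv \<phi>"] by auto
  obtain \<phi>' where \<phi>': "fv \<phi>' \<subseteq> f(x := y) ` fv \<phi>" "\<And>e. sat M e \<phi>' = sat M (\<lambda>i. e ((f(x := y)) i)) \<phi>"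
    using Exists.IH by blast
  have "sat M (\<lambda>i. (e(y := a)) ((f(x := y)) i)) \<phi> = sat M ((\<lambda>i. e (f i))(x := a)) \<phi>" for e a
    using y by (intro sat_cong) auto
  moreover have "fv (Exists y \<phi>') \<subseteq> f ` fv (Exists x \<phi>)" using \<phi>'(1) by auto
  ultimately show ?case by (intro exI[of _ "Exists y \<phi>'"]) (simp add: \<phi>'(2) del: fun_upd_apply)
qed

text \<open>Interleaving reserves infinitely many places for the assignment and for the parameters,
  so no bound on the free variables of a formula has to be tracked.\<close>

definition mix :: "(nat \<Rightarrow> 'a) \<Rightarrow> (nat \<Rightarrow> 'a) \<Rightarrow> nat \<Rightarrow> 'a" where
  "mix e p i = (if even i then e (i div 2) else p (i div 2))"

lemma mix_simps [simp]: "mix e p (2 * i) = e i" "mix e p (Suc (2 * i)) = p i"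
  by (simp_all add: mix_def)

lemma mix_upd_0: "(mix e p)(0 := a) = mix (e(0 := a)) p"
proof
  fix i :: nat
  have "i = 0 \<or> odd i \<or> i div 2 \<noteq> 0" by presburger
  then show "((mix e p)(0 := a)) i = mix (e(0 := a)) p i" by (auto simp: mix_def)
qed

lemma range_mix: "range e \<subseteq> A \<Longrightarrow> range p \<subseteq> A \<Longrightarrow> range (mix e p) \<subseteq> A"
  by (auto simp: mix_def)

text \<open>
  A predicate on assignments is definable if it is given by a formula whose even variables refer
  to the assignment and whose odd variables refer to parameters.
\<close>

definition dfn :: "('p, 'a) struc \<Rightarrow> ((nat \<Rightarrow> 'a) \<Rightarrow> bool) \<Rightarrow> bool" where
  "dfn M P \<longleftrightarrow> (\<exists>\<phi> p. range p \<subseteq> univ M \<and>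
     (\<forall>e. range e \<subseteq> univ M \<longrightarrow> P e = sat M (mix e p) \<phi>))"

lemma dfn_cong:
  assumes "dfn M P" "\<And>e. range e \<subseteq> univ M \<Longrightarrow> Q e = P e"
  shows "dfn M Q"
  using assms(1) by (simp add: dfn_def assms(2))

named_theorems dfn_intros

lemma dfn_neg [dfn_intros]: "dfn M P \<Longrightarrow> dfn M (\<lambda>e. \<not> P e)"
proof -
  assume "dfn M P"
  then obtain \<phi> p where "range p \<subseteq> univ M \<and> (\<forall>e. range e \<subseteq> univ M \<longrightarrow> P e = sat M (mix e p) \<phi>)"
    unfolding dfn_def by blast
  then show ?thesis unfolding dfn_def by (intro exI[of _ "Neg \<phi>"] exI[of _ p]) simp
qed

text \<open>Simultaneous substitution: \<open>Inl\<close> sends a variable to another variable,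
  \<open>Inr\<close> to a fixed element of the universe.\<close>

lemma dfn_rename:
  assumes P: "dfn M P" and f: "\<And>i c. f i = Inr c \<Longrightarrow> c \<in> univ M"
  shows "dfn M (\<lambda>e. P (\<lambda>i. case f i of Inl j \<Rightarrow> e j | Inr c \<Rightarrow> c))"
proof -
  obtain \<phi> p where p: "range p \<subseteq> univ M"
    and \<phi>: "\<And>e. range e \<subseteq> univ M \<Longrightarrow> P e = sat M (mix e p) \<phi>"
    using P by (auto simp: dfn_def)
  define g where "g n = (if even n then case f (n div 2) of Inl j \<Rightarrow> 2 * j | Inr c \<Rightarrow> Suc (2 * n)
    else Suc (2 * n))" for n
  \<comment> \<open>The new parameters hold the substituted elements at even places and the old
    parameters at odd places; \<open>p 0\<close> is only a filler.\<close>
  define p' where "p' n = (if even n then case f (n div 2) of Inl j \<Rightarrow> p 0 | Inr c \<Rightarrow> c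
    else p (n div 2))" for n
  obtain \<phi>' where \<phi>': "\<And>e. sat M e \<phi>' = sat M (\<lambda>i. e (g i)) \<phi>" using ex_rename by blast
  have "(\<lambda>n. mix e p' (g n)) = mix (\<lambda>i. case f i of Inl j \<Rightarrow> e j | Inr c \<Rightarrow> c) p" for e
  proof
    fix n
    show "mix e p' (g n) = mix (\<lambda>i. case f i of Inl j \<Rightarrow> e j | Inr c \<Rightarrow> c) p n"
      by (cases "even n"; cases "f (n div 2)") (auto simp: g_def p'_def elim!: evenE oddE)
  qed
  moreover have "range (\<lambda>i. case f i of Inl j \<Rightarrow> e j | Inr c \<Rightarrow> c) \<subseteq> univ M"
    if "range e \<subseteq> univ M" for e
    using that f by (force split: sum.splits)
  ultimately have "P (\<lambda>i. case f i of Inl j \<Rightarrow> e j | Inr c \<Rightarrow> c) = sat M (mix e p') \<phi>'"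
    if "range e \<subseteq> univ M" for e
    using that by (simp add: \<phi> \<phi>')
  moreover have "range p' \<subseteq> univ M" using p f by (force simp: p'_def split: sum.splits)
  ultimately show ?thesis unfolding dfn_def by blast
qed

lemma dfn_rename_var: "dfn M P \<Longrightarrow> dfn M (\<lambda>e. P (\<lambda>i. e (f i)))"
  using dfn_rename[of M P "\<lambda>i. Inl (f i)"] by simp

lemma dfn_sat:
  assumes "univ M \<noteq> {}"
  shows "dfn M (\<lambda>e :: nat \<Rightarrow> 'a. sat M e \<phi>)"
proof -
  obtain \<phi>' where \<phi>': "\<And>e. sat M e \<phi>' = sat M (\<lambda>i. e (2 * i)) \<phi>" using ex_rename by blast
  obtain u where "u \<in> univ M" using assms by blast
  then show ?thesis
    unfolding dfn_def by (intro exI[of _ \<phi>'] exI[of _ "\<lambda>_. u"]) (auto simp: \<phi>')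
qed

lemma dfn_conj [dfn_intros]:
  assumes "dfn M P" "dfn M Q"
  shows "dfn M (\<lambda>e. P e \<and> Q e)"
proof -
  obtain \<phi> p where p: "range p \<subseteq> univ M"
    and \<phi>: "\<And>e. range e \<subseteq> univ M \<Longrightarrow> P e = sat M (mix e p) \<phi>"
    using assms(1) by (auto simp: dfn_def)
  obtain \<psi> q where q: "range q \<subseteq> univ M"
    and \<psi>: "\<And>e. range e \<subseteq> univ M \<Longrightarrow> Q e = sat M (mix e q) \<psi>"
    using assms(2) by (auto simp: dfn_def)
  \<comment> \<open>The parameter sequences \<open>p\<close> and \<open>q\<close> are merged by
    \<open>mix p q\<close>; \<open>f\<close> and \<open>g\<close> send the odd variables to their
    respective halves and leave the even ones alone.\<close>
  define f where "f n = (if even n then n else 2 * n - 1)" for n :: nat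
  define g where "g n = (if even n then n else 2 * n + 1)" for n :: nat
  obtain \<phi>' where \<phi>': "\<And>e. sat M e \<phi>' = sat M (\<lambda>i. e (f i)) \<phi>" using ex_rename by blast
  obtain \<psi>' where \<psi>': "\<And>e. sat M e \<psi>' = sat M (\<lambda>i. e (g i)) \<psi>" using ex_rename by blast
  have "mix e (mix p q) (f n) = mix e p n" "mix e (mix p q) (g n) = mix e q n" for e n
  proof -
    have "\<exists>k. n = 2 * k \<or> n = Suc (2 * k)" by presburger
    then consider (even) k where "n = 2 * k" | (odd) k where "n = Suc (2 * k)" by blast
    then have "mix e (mix p q) (f n) = mix e p n \<and> mix e (mix p q) (g n) = mix e q n"
    proof cases
      case odd
      have "f n = Suc (2 * (2 * k))" "g n = Suc (2 * Suc (2 * k))" by (simp_all add: f_def g_def odd)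
      then show ?thesis by (simp only: mix_simps odd)
    qed (simp add: f_def g_def)
    then show "mix e (mix p q) (f n) = mix e p n" "mix e (mix p q) (g n) = mix e q n" by blast+
  qed
  then have "(\<lambda>n. mix e (mix p q) (f n)) = mix e p" "(\<lambda>n. mix e (mix p q) (g n)) = mix e q" for e
    by (auto simp: fun_eq_iff)
  then show ?thesis
    unfolding dfn_def using range_mix[OF p q] \<phi> \<psi>
    by (intro exI[of _ "Conj \<phi>' \<psi>'"] exI[of _ "mix p q"]) (simp add: \<phi>' \<psi>')
qed

text \<open>
  In the quantifier rules the bound variable becomes variable \<open>0\<close> and the others are shifted, as with
  de Bruijn indices; so \<open>dfn_intros\<close> proves definability by following the structure of a predicate.
\<close>

lemma dfn_ex [dfn_intros]:
  assumes "dfn M (\<lambda>e. R (\<lambda>i. e (Suc i)) (e 0))"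
  shows "dfn M (\<lambda>e. \<exists>a\<in>univ M. R e a)"
proof -
  obtain \<phi> p where p: "range p \<subseteq> univ M"
    and \<phi>: "\<And>e. range e \<subseteq> univ M \<Longrightarrow> R (\<lambda>i. e (Suc i)) (e 0) = sat M (mix e p) \<phi>"
    using assms by (auto simp: dfn_def)
  have "(\<exists>a\<in>univ M. R (\<lambda>i. e (Suc i)) a) = sat M (mix e p) (Exists 0 \<phi>)"
    if "range e \<subseteq> univ M" for e
  proof -
    have "R (\<lambda>i. e (Suc i)) a = sat M (mix (e(0 := a)) p) \<phi>" if "a \<in> univ M" for a
      using \<phi>[of "e(0 := a)"] that \<open>range e \<subseteq> univ M\<close> by auto
    then show ?thesis by (simp add: mix_upd_0)
  qed
  then have "dfn M (\<lambda>e. \<exists>a\<in>univ M. R (\<lambda>i. e (Suc i)) a)"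
    unfolding dfn_def using p by blast
  \<comment> \<open>\<open>Exists 0\<close> overwrites variable \<open>0\<close>, so the predicate
    obtained so far reads the assignment from variable \<open>1\<close> on; shifting down restores
    \<open>e\<close>.\<close>
  from dfn_rename_var[OF this, of "\<lambda>i. i - 1"] show ?thesis by simp
qed

lemma dfn_disj [dfn_intros]: "dfn M P \<Longrightarrow> dfn M Q \<Longrightarrow> dfn M (\<lambda>e. P e \<or> Q e)"
  using dfn_neg[OF dfn_conj[OF dfn_neg dfn_neg]] by simp

lemma dfn_imp [dfn_intros]: "dfn M P \<Longrightarrow> dfn M Q \<Longrightarrow> dfn M (\<lambda>e. P e \<longrightarrow> Q e)"
  using dfn_neg[OF dfn_conj[OF _ dfn_neg]] by simp

lemma dfn_iff [dfn_intros]: "dfn M P \<Longrightarrow> dfn M Q \<Longrightarrow> dfn M (\<lambda>e. P e \<longleftrightarrow> Q e)"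
  using dfn_conj[OF dfn_imp dfn_imp, of M P Q Q P] by (rule dfn_cong) auto

lemma dfn_all [dfn_intros]:
  "dfn M (\<lambda>e. R (\<lambda>i. e (Suc i)) (e 0)) \<Longrightarrow> dfn M (\<lambda>e. \<forall>a\<in>univ M. R e a)"
  using dfn_neg[OF dfn_ex[of M "\<lambda>e a. \<not> R e a", OF dfn_neg]] by simp

section \<open>Definable functions and substitution\<close>

definition tm :: "('p, 'a) struc \<Rightarrow> ((nat \<Rightarrow> 'a) \<Rightarrow> 'a) \<Rightarrow> bool" where
  "tm M t \<longleftrightarrow> (\<forall>e. range e \<subseteq> univ M \<longrightarrow> t e \<in> univ M) \<and> dfn M (\<lambda>e. e 0 = t (\<lambda>i. e (Suc i)))"

lemma range_shift: "range e \<subseteq> A \<Longrightarrow> range (\<lambda>i. e (f i)) \<subseteq> A"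
  by auto

lemma dfn_var_eq:
  assumes "univ M \<noteq> {}"
  shows "dfn M (\<lambda>e. e i = e j)"
  using dfn_sat[OF assms, of "Eq i j"] by simp

lemma tm_var: "univ M \<noteq> {} \<Longrightarrow> tm M (\<lambda>e. e i)"
  unfolding tm_def using dfn_var_eq[of M 0 "Suc i"] by (simp add: range_subsetD)

lemma tm_const [dfn_intros]:
  fixes M :: "('p, 'a) struc"
  assumes "c \<in> univ M"
  shows "tm M (\<lambda>e. c)"
proof -
  define f :: "nat \<Rightarrow> nat + 'a" where "f i = (if i = 0 then Inl 0 else Inr c)" for i
  have "dfn M (\<lambda>e. e 0 = e 1)" using assms by (intro dfn_var_eq) auto
  moreover have "c' \<in> univ M" if "f i = Inr c'" for i c'
    using assms that by (auto simp: f_def split: if_splits)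
  ultimately have "dfn M (\<lambda>e. (case f 0 of Inl j \<Rightarrow> e j | Inr c \<Rightarrow> c) = (case f 1 of Inl j \<Rightarrow> e j | Inr c \<Rightarrow> c))"
    by (rule dfn_rename)
  then show ?thesis using assms by (simp add: tm_def f_def)
qed

text \<open>The language has no function symbols, so a term is substituted by quantifying over its
  value, which lies in the universe.\<close>

lemma dfn_subst:
  assumes R: "dfn M (\<lambda>e. R (\<lambda>i. e (Suc i)) (e 0))" and t: "tm M t"
  shows "dfn M (\<lambda>e. R e (t e))"
proof -
  have "dfn M (\<lambda>e. \<exists>a\<in>univ M. a = t e \<and> R e a)"
    using t R by (intro dfn_ex dfn_conj) (simp_all add: tm_def)
  then show ?thesis
    by (rule dfn_cong) (use t in \<open>auto simp: tm_def\<close>)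
qed

definition dfn1 :: "('p, 'a) struc \<Rightarrow> ('a \<Rightarrow> bool) \<Rightarrow> bool" where
  "dfn1 M R \<longleftrightarrow> dfn M (\<lambda>e. R (e 0))"

definition dfn2 :: "('p, 'a) struc \<Rightarrow> ('a \<Rightarrow> 'a \<Rightarrow> bool) \<Rightarrow> bool" where
  "dfn2 M R \<longleftrightarrow> dfn M (\<lambda>e. R (e 0) (e 1))"

lemma dfn1_app: "dfn1 M R \<Longrightarrow> tm M t \<Longrightarrow> dfn M (\<lambda>e. R (t e))"
  unfolding dfn1_def by (rule dfn_subst[of M "\<lambda>e. R"])

lemma tm_rename_var: "tm M t \<Longrightarrow> tm M (\<lambda>e. t (\<lambda>i. e (f i)))"
  unfolding tm_def
  using dfn_rename_var[of M "\<lambda>e. e 0 = t (\<lambda>i. e (Suc i))" "case_nat 0 (\<lambda>i. Suc (f i))"]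
  by (simp add: range_shift)

lemma dfn2_app:
  assumes "dfn2 M R" "tm M s" "tm M t"
  shows "dfn M (\<lambda>e. R (s e) (t e))"
proof (rule dfn_subst[of M "\<lambda>e. R (s e)", OF _ assms(3)])
  have "dfn M (\<lambda>e. R (e 0) (e (Suc 0)))" using assms(1) by (simp add: dfn2_def)
  then show "dfn M (\<lambda>e. R (s (\<lambda>i. e (Suc i))) (e 0))"
    using tm_rename_var[OF assms(2), of Suc]
    by (rule dfn_subst[of M "\<lambda>e a. R a (e 0)" "\<lambda>e. s (\<lambda>i. e (Suc i))"])
qed

lemma tm_nonempty: "tm M t \<Longrightarrow> univ M \<noteq> {}"
  unfolding tm_def dfn_def by blast

lemma dfn_eq [dfn_intros]: "tm M s \<Longrightarrow> tm M t \<Longrightarrow> dfn M (\<lambda>e. s e = t e)"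
  by (rule dfn2_app[of M "(=)"]) (simp_all add: dfn2_def dfn_var_eq tm_nonempty)

lemma dfn_bool: "univ M \<noteq> {} \<Longrightarrow> dfn M (\<lambda>e. b)"
  using dfn_var_eq[of M 0 0] dfn_neg[OF dfn_var_eq[of M 0 0]] by (cases b) auto

lemma tm_fun:
  assumes "dfn M (\<lambda>e. R (\<lambda>i. e (Suc i)) (e 0))"
    and "\<And>e. range e \<subseteq> univ M \<Longrightarrow> t e \<in> univ M"
    and "\<And>e y. range e \<subseteq> univ M \<Longrightarrow> y \<in> univ M \<Longrightarrow> y = t e \<longleftrightarrow> R e y"
  shows "tm M t"
  unfolding tm_def
proof (intro conjI allI impI)
  show "dfn M (\<lambda>e. e 0 = t (\<lambda>i. e (Suc i)))"
    using assms(1) by (rule dfn_cong) (rule assms(3), auto)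
qed (use assms(2) in blast)

section \<open>Models of ZF and their definable classes\<close>

definition mem_in :: "'a \<Rightarrow> (set_pred, 'a) struc \<Rightarrow> 'a \<Rightarrow> bool"
    (\<open>_ \<in>\<^bsub>_\<^esub> _\<close> [51, 0, 51] 50) where
  "x \<in>\<^bsub>M\<^esub> y \<longleftrightarrow> [x, y] \<in> rel M Mem"

lemma dfn_mem [dfn_intros]:
  assumes "tm M s" "tm M t"
  shows "dfn M (\<lambda>e. s e \<in>\<^bsub>M\<^esub> t e)"
proof -
  have "dfn2 M (\<lambda>x y. x \<in>\<^bsub>M\<^esub> y)"
    using dfn_sat[OF tm_nonempty[OF assms(1)], of "0 \<epsilon> 1"] by (simp add: dfn2_def mem_in_def)
  then show ?thesis using assms by (rule dfn2_app)
qed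

text \<open>A definite description rather than a choice, so that the value depends definably on the
  parameters; it is unspecified when no such set exists.\<close>

definition the_set :: "(set_pred, 'a) struc \<Rightarrow> ('a \<Rightarrow> bool) \<Rightarrow> 'a" where
  "the_set M P = (THE y. y \<in> univ M \<and> (\<forall>x\<in>univ M. x \<in>\<^bsub>M\<^esub> y \<longleftrightarrow> P x))"

definition sub :: "(set_pred, 'a) struc \<Rightarrow> 'a \<Rightarrow> 'a \<Rightarrow> bool" where
  "sub M x y \<longleftrightarrow> (\<forall>z\<in>univ M. z \<in>\<^bsub>M\<^esub> x \<longrightarrow> z \<in>\<^bsub>M\<^esub> y)"

definition upair :: "(set_pred, 'a) struc \<Rightarrow> 'a \<Rightarrow> 'a \<Rightarrow> 'a" where
  "upair M x y = the_set M (\<lambda>z. z = x \<or> z = y)"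

definition Uni :: "(set_pred, 'a) struc \<Rightarrow> 'a \<Rightarrow> 'a" where
  "Uni M x = the_set M (\<lambda>z. \<exists>y\<in>univ M. z \<in>\<^bsub>M\<^esub> y \<and> y \<in>\<^bsub>M\<^esub> x)"

definition Pw :: "(set_pred, 'a) struc \<Rightarrow> 'a \<Rightarrow> 'a" where
  "Pw M x = the_set M (\<lambda>z. sub M z x)"

definition pr :: "(set_pred, 'a) struc \<Rightarrow> 'a \<Rightarrow> 'a \<Rightarrow> 'a" where
  "pr M x y = upair M (upair M x x) (upair M x y)"

definition ins :: "(set_pred, 'a) struc \<Rightarrow> 'a \<Rightarrow> 'a \<Rightarrow> 'a" where
  "ins M x y = Uni M (upair M (upair M x x) y)"

definition emp :: "(set_pred, 'a) struc \<Rightarrow> 'a" where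
  "emp M = the_set M (\<lambda>z. False)"

text \<open>
  Unfolding the semantics of the abbreviations of \<open>Defs\<close> with these rules keeps biconditionals intact,
  which simplification would split.
\<close>

lemma sat_raw:
  "(\<not> (\<exists>a\<in>S. \<not> P a)) = (\<forall>a\<in>S. P a)" "(\<not> (A \<and> \<not> B)) = (A \<longrightarrow> B)"
  "((A \<longrightarrow> B) \<and> (B \<longrightarrow> A)) = (A = B)"
  by blast+

section \<open>The axioms as statements about definable classes\<close>

locale zf_model =
  fixes M :: "(set_pred, 'a) struc"
  assumes models: "models set_ar M ZF"
begin

abbreviation U :: "'a set" where "U \<equiv> univ M"
abbreviation mem' :: "'a \<Rightarrow> 'a \<Rightarrow> bool" (infix \<open>\<in>\<in>\<close> 50) where "x \<in>\<in> y \<equiv> x \<in>\<^bsub>M\<^esub> y"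

lemma nonempty [simp]: "U \<noteq> {}"
  using models by (simp add: models_def is_struc_def)

lemma mem_univ: "x \<in>\<in> y \<Longrightarrow> x \<in> U" "x \<in>\<in> y \<Longrightarrow> y \<in> U"
  using models unfolding models_def is_struc_def mem_in_def
  by (metis list.set_intros nlistsE_set subset_iff)+

lemma tm_var' [dfn_intros]: "tm M (\<lambda>e. e i)"
  by (rule tm_var) simp

lemma dfn_const [dfn_intros]: "dfn M (\<lambda>e. b)"
  by (rule dfn_bool) simp

lemma axiom: "\<phi> \<in> ZF \<Longrightarrow> range e \<subseteq> U \<Longrightarrow> sat M e \<phi>"
  using models by (simp add: models_def)

lemma ext:
  assumes "x \<in> U" "y \<in> U" "\<And>z. z \<in> U \<Longrightarrow> z \<in>\<in> x \<longleftrightarrow> z \<in>\<in> y"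
  shows "x = y"
proof -
  have "sat M (\<lambda>_. x) extensionality_ax" by (rule axiom) (use assms in \<open>auto simp: ZF_def\<close>)
  then show ?thesis using assms by (auto simp: extensionality_ax_def simp flip: mem_in_def)
qed

lemma set_foundation:
  assumes "x \<in> U" "y \<in> U" "y \<in>\<in> x"
  shows "\<exists>m\<in>U. m \<in>\<in> x \<and> (\<forall>z\<in>U. z \<in>\<in> x \<longrightarrow> \<not> z \<in>\<in> m)"
proof -
  have "sat M (\<lambda>_. x) foundation_ax" by (rule axiom) (use assms in \<open>auto simp: ZF_def\<close>)
  then show ?thesis using assms by (auto simp: foundation_ax_def simp flip: mem_in_def)
qed

lemma separation:
  assumes P: "dfn1 M P" and z: "z \<in> U"
  shows "\<exists>y\<in>U. \<forall>x\<in>U. x \<in>\<in> y \<longleftrightarrow> x \<in>\<in> z \<and> P x"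
proof -
  obtain \<phi> p where p: "range p \<subseteq> U"
    and \<phi>: "\<And>e. range e \<subseteq> U \<Longrightarrow> P (e 0) = sat M (mix e p) \<phi>"
    using P by (auto simp: dfn1_def dfn_def)
  \<comment> \<open>All even variables are read as variable \<open>0\<close>, the element tested;
    the parameters go to the odd variables from \<open>3\<close> on, leaving \<open>1\<close> and
    \<open>2\<close> to the bound set variables of the scheme.\<close>
  define f where "f i = (if even i then 0 else i + 2)" for i :: nat
  define e where "e i = p ((i - 3) div 2)" for i :: nat
  obtain \<phi>' where \<phi>': "fv \<phi>' \<subseteq> f ` fv \<phi>" "\<And>e. sat M e \<phi>' = sat M (\<lambda>i. e (f i)) \<phi>"
    using ex_rename by blast
  have f1: "f i \<noteq> 1" "f i \<noteq> 2" "odd i \<Longrightarrow> f i \<noteq> 0" "odd i \<Longrightarrow> f i - 3 = i - 1" for i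
    by (auto simp: f_def elim!: oddE)
  have P': "sat M (e(2 := z, 1 := y, 0 := x)) \<phi>' \<longleftrightarrow> P x" if "x \<in> U" for x y z
  proof -
    have "(\<lambda>i. (e(2 := z, 1 := y, 0 := x)) (f i)) = mix (\<lambda>_. x) p"
      using f1 by (auto simp: fun_eq_iff mix_def e_def f_def elim!: oddE)
    then show ?thesis using \<phi>[of "\<lambda>_. x"] that by (simp add: \<phi>' image_subset_iff)
  qed
  have "1 \<notin> fv \<phi>'" using \<phi>'(1) f1(1) by (metis imageE subsetD)
  then have "Defs.separation 0 1 2 \<phi>' \<in> ZF"
    unfolding ZF_def by - (rule UnI1, rule UnI2, rule CollectI, rule exI[of _ 0], rule exI[of _ 1], rule exI[of _ 2],
        rule exI[of _ \<phi>'], simp)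
  then have "sat M e (Defs.separation 0 1 2 \<phi>')" by (rule axiom) (use p in \<open>auto simp: e_def\<close>)
  then have "\<forall>z\<in>U. \<exists>y\<in>U. \<forall>x\<in>U. x \<in>\<in> y \<longleftrightarrow> x \<in>\<in> z \<and> sat M (e(2 := z, 1 := y, 0 := x)) \<phi>'"
    unfolding separation_def sat.simps sat_raw by (simp flip: mem_in_def)
  then show ?thesis using P'[OF _ ] z by (simp del: fun_upd_apply)
qed

lemma replacement:
  assumes R: "dfn2 M R" and a: "a \<in> U"
    and fn: "\<And>x. x \<in> U \<Longrightarrow> x \<in>\<in> a \<Longrightarrow> \<exists>c\<in>U. \<forall>y\<in>U. R x y \<longleftrightarrow> y = c"
  shows "\<exists>b\<in>U. \<forall>x\<in>U. x \<in>\<in> a \<longrightarrow> (\<exists>y\<in>U. y \<in>\<in> b \<and> R x y)"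
proof -
  obtain \<phi> p where p: "range p \<subseteq> U"
    and \<phi>: "\<And>e. range e \<subseteq> U \<Longrightarrow> R (e 0) (e 1) = sat M (mix e p) \<phi>"
    using R by (auto simp: dfn2_def dfn_def)
  \<comment> \<open>The two arguments of \<open>R\<close> sit at places \<open>0\<close> and
    \<open>2\<close> of \<open>mix\<close> and become variables \<open>0\<close> and
    \<open>1\<close>; the parameters go to the odd variables from \<open>5\<close> on, leaving
    \<open>2\<close>, \<open>3\<close> and \<open>4\<close> for the bound variables of the
    scheme.\<close>
  define f where "f i = (if odd i then i + 4 else if i = 2 then 1 else 0)" for i :: nat
  define e where "e i = p ((i - 5) div 2)" for i :: nat
  obtain \<phi>' where \<phi>': "fv \<phi>' \<subseteq> f ` fv \<phi>" "\<And>e. sat M e \<phi>' = sat M (\<lambda>i. e (f i)) \<phi>"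
    using ex_rename by blast
  have f1: "f i \<noteq> 2" "f i \<noteq> 3" "f i \<noteq> 4" for i
    by (auto simp: f_def elim!: oddE)
  have R': "sat M e' \<phi>' \<longleftrightarrow> R (e' 0) (e' 1)" if "e' 0 \<in> U" "e' 1 \<in> U" "\<forall>i\<ge>5. e' i = e i" for e'
  proof -
    have "e' (f i) = mix (\<lambda>i. if i = 1 then e' 1 else e' 0) p i" for i
    proof (cases "odd i")
      case True
      then obtain k where "i = Suc (2 * k)" by (metis oddE Suc_eq_plus1)
      then show ?thesis using that(3) by (simp add: f_def mix_def e_def)
    next
      case False
      then have "i div 2 = 1 \<longleftrightarrow> i = 2" by presburger
      then show ?thesis using False by (simp add: f_def mix_def)
    qed
    then have "(\<lambda>i. e' (f i)) = mix (\<lambda>i. if i = 1 then e' 1 else e' 0) p" by blast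
    then show ?thesis
      using \<phi>[of "\<lambda>i. if i = 1 then e' 1 else e' 0"] that by (auto simp: \<phi>' image_subset_iff)
  qed
  have "3 \<notin> fv \<phi>'" "4 \<notin> fv \<phi>'" using \<phi>'(1) f1(2,3) by (metis imageE subsetD)+
  then have "Defs.replacement 2 3 0 1 4 \<phi>' \<in> ZF"
    unfolding ZF_def by - (rule UnI2, rule CollectI, rule exI[of _ 2], rule exI[of _ 3], rule exI[of _ 0],
        rule exI[of _ 1], rule exI[of _ 4], rule exI[of _ \<phi>'], simp)
  then have "sat M e (Defs.replacement 2 3 0 1 4 \<phi>')" by (rule axiom) (use p in \<open>auto simp: e_def\<close>)
  then have "\<forall>a\<in>U. (\<forall>x\<in>U. x \<in>\<in> a \<longrightarrow> (\<exists>c\<in>U. \<forall>y\<in>U. R x y \<longleftrightarrow> y = c)) \<longrightarrow>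
      (\<exists>b\<in>U. \<forall>x\<in>U. x \<in>\<in> a \<longrightarrow> (\<exists>y\<in>U. y \<in>\<in> b \<and> R x y))"
    unfolding replacement_def Exists1_def sat.simps sat_raw by (simp add: R' flip: mem_in_def)
  then show ?thesis using a fn by blast
qed

text \<open>Replacement asks for a value at every member of the set and yields only a set including
  the range. So \<open>a\<close> is first cut down to the domain of \<open>R\<close>, and the range
  is separated out afterwards.\<close>

lemma image:
  assumes R: "dfn2 M R" and a: "a \<in> U"
    and fn: "\<And>x y y'. x \<in> U \<Longrightarrow> x \<in>\<in> a \<Longrightarrow> y \<in> U \<Longrightarrow> y' \<in> U \<Longrightarrow> R x y \<Longrightarrow> R x y' \<Longrightarrow> y = y'"
  shows "\<exists>b\<in>U. \<forall>y\<in>U. y \<in>\<in> b \<longleftrightarrow> (\<exists>x\<in>U. x \<in>\<in> a \<and> R x y)"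
proof -
  have "dfn1 M (\<lambda>x. \<exists>y\<in>U. R x y)"
    unfolding dfn1_def by (intro dfn_intros dfn2_app[OF R])
  then obtain a' where a': "a' \<in> U" "\<forall>x\<in>U. x \<in>\<in> a' \<longleftrightarrow> x \<in>\<in> a \<and> (\<exists>y\<in>U. R x y)"
    using separation[OF _ a] by blast
  have "\<exists>b\<in>U. \<forall>x\<in>U. x \<in>\<in> a' \<longrightarrow> (\<exists>y\<in>U. y \<in>\<in> b \<and> R x y)"
    by (rule replacement[OF R a'(1)]) (use a' fn in blast)
  then obtain b where b: "b \<in> U" "\<forall>x\<in>U. x \<in>\<in> a' \<longrightarrow> (\<exists>y\<in>U. y \<in>\<in> b \<and> R x y)" by blast
  have "dfn1 M (\<lambda>y. \<exists>x\<in>U. x \<in>\<in> a \<and> R x y)"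
    unfolding dfn1_def by (intro dfn_intros dfn2_app[OF R] a)
  then obtain c where c: "c \<in> U" "\<forall>y\<in>U. y \<in>\<in> c \<longleftrightarrow> y \<in>\<in> b \<and> (\<exists>x\<in>U. x \<in>\<in> a \<and> R x y)"
    using separation[OF _ b(1)] by blast
  have yb: "y \<in>\<in> b" if "y \<in> U" "x \<in> U" "x \<in>\<in> a" "R x y" for x y
    using that a' b fn by metis
  show ?thesis
  proof (rule bexI[OF _ c(1)], intro ballI iffI)
    fix y assume y: "y \<in> U" "\<exists>x\<in>U. x \<in>\<in> a \<and> R x y"
    then have "y \<in>\<in> b" using yb by (elim bexE conjE)
    with y c(2) show "y \<in>\<in> c" by (simp del: bex_simps)
  qed (simp add: c(2))
qed

lemma the_set:
  assumes "\<exists>y\<in>U. \<forall>x\<in>U. x \<in>\<in> y \<longleftrightarrow> P x"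
  shows "the_set M P \<in> U" "x \<in> U \<Longrightarrow> x \<in>\<in> the_set M P \<longleftrightarrow> P x"
proof -
  obtain y where y: "y \<in> U" "\<forall>x\<in>U. x \<in>\<in> y \<longleftrightarrow> P x" using assms by (elim bexE)
  have "z = y" if "z \<in> U \<and> (\<forall>x\<in>U. x \<in>\<in> z \<longleftrightarrow> P x)" for z
    using that y by (intro ext) simp_all
  with y have "\<exists>!y. y \<in> U \<and> (\<forall>x\<in>U. x \<in>\<in> y \<longleftrightarrow> P x)" by (intro ex1I[of _ y] conjI)
  then have "the_set M P \<in> U \<and> (\<forall>x\<in>U. x \<in>\<in> the_set M P \<longleftrightarrow> P x)"
    unfolding the_set_def by (rule theI')
  then show "the_set M P \<in> U" "x \<in> U \<Longrightarrow> x \<in>\<in> the_set M P \<longleftrightarrow> P x" by auto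
qed

lemma the_set_eqI:
  assumes "y \<in> U" "\<And>x. x \<in> U \<Longrightarrow> x \<in>\<in> y \<longleftrightarrow> P x"
  shows "y = the_set M P"
proof -
  have "\<exists>y\<in>U. \<forall>x\<in>U. x \<in>\<in> y \<longleftrightarrow> P x" using assms by (intro bexI[of _ y]) simp_all
  note * = the_set[OF this]
  show ?thesis by (rule ext) (simp_all add: assms *)
qed

text \<open>By extensionality the value is characterised by its members, and this is a definable
  condition on it.\<close>

lemma tm_the_set:
  fixes P :: "(nat \<Rightarrow> 'a) \<Rightarrow> 'a \<Rightarrow> bool"
  assumes ex: "\<And>e. range e \<subseteq> U \<Longrightarrow> \<exists>y\<in>U. \<forall>x\<in>U. x \<in>\<in> y \<longleftrightarrow> P e x"
    and P: "dfn M (\<lambda>e. P (\<lambda>i. e (Suc i)) (e 0))"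
  shows "tm M (\<lambda>e. the_set M (P e))"
proof (rule tm_fun[of _ "\<lambda>e y. \<forall>x\<in>U. x \<in>\<in> y \<longleftrightarrow> P e x"])
  \<comment> \<open>Under the quantifier over \<open>x\<close>, variable \<open>0\<close> is
    \<open>x\<close> and variable \<open>1\<close> the candidate for the value, so the assignment
    starts at \<open>2\<close>.\<close>
  have "dfn M (\<lambda>e. P (\<lambda>i. e (Suc (Suc i))) (e 0))"
    using dfn_rename_var[OF P, of "case_nat 0 (\<lambda>i. Suc (Suc i))"] by simp
  then show "dfn M (\<lambda>e. \<forall>x\<in>U. x \<in>\<in> e 0 \<longleftrightarrow> P (\<lambda>i. e (Suc i)) x)" by (intro dfn_intros)
next
  fix e :: "nat \<Rightarrow> 'a" and y assume "range e \<subseteq> U" "y \<in> U"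
  then show "y = the_set M (P e) \<longleftrightarrow> (\<forall>x\<in>U. x \<in>\<in> y \<longleftrightarrow> P e x)"
    by (auto simp: the_set[OF ex] intro: the_set_eqI)
qed (rule the_set[OF ex])

section \<open>Set operations as definable functions\<close>

lemma sub_refl [simp]: "sub M x x"
  by (simp add: sub_def)

lemma sub_trans: "sub M x y \<Longrightarrow> sub M y z \<Longrightarrow> sub M x z"
  by (simp add: sub_def)

lemma sub_antisym: "x \<in> U \<Longrightarrow> y \<in> U \<Longrightarrow> sub M x y \<Longrightarrow> sub M y x \<Longrightarrow> x = y"
  unfolding sub_def by (rule ext) blast+

lemma dfn_sub [dfn_intros]:
  assumes "tm M s" "tm M t"
  shows "dfn M (\<lambda>e. sub M (s e) (t e))"
  unfolding sub_def by (intro dfn_intros assms[THEN tm_rename_var, of Suc])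

lemma upair_ex:
  assumes "x \<in> U" "y \<in> U"
  shows "\<exists>u\<in>U. \<forall>z\<in>U. z \<in>\<in> u \<longleftrightarrow> z = x \<or> z = y"
proof -
  have "sat M (\<lambda>_. x) pairing_ax" by (rule axiom) (use assms in \<open>auto simp: ZF_def\<close>)
  then have "\<forall>x\<in>U. \<forall>y\<in>U. \<exists>u\<in>U. \<forall>z\<in>U. z \<in>\<in> u \<longleftrightarrow> (z \<noteq> x \<longrightarrow> z = y)"
    unfolding pairing_ax_def sat.simps sat_raw by (simp flip: mem_in_def)
  then show ?thesis using assms unfolding disj_imp by blast
qed

lemma Uni_ex:
  assumes "x \<in> U"
  shows "\<exists>u\<in>U. \<forall>z\<in>U. z \<in>\<in> u \<longleftrightarrow> (\<exists>y\<in>U. z \<in>\<in> y \<and> y \<in>\<in> x)"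
proof -
  have "sat M (\<lambda>_. x) union_ax" by (rule axiom) (use assms in \<open>auto simp: ZF_def\<close>)
  then have "\<forall>x\<in>U. \<exists>u\<in>U. \<forall>z\<in>U. z \<in>\<in> u \<longleftrightarrow> (\<exists>y\<in>U. y \<in>\<in> x \<and> z \<in>\<in> y)"
    unfolding union_ax_def sat.simps sat_raw by (simp flip: mem_in_def)
  then show ?thesis using assms by (simp add: conj_commute)
qed

lemma Pw_ex:
  assumes "x \<in> U"
  shows "\<exists>u\<in>U. \<forall>z\<in>U. z \<in>\<in> u \<longleftrightarrow> sub M z x"
proof -
  have "sat M (\<lambda>_. x) powerset_ax" by (rule axiom) (use assms in \<open>auto simp: ZF_def\<close>)
  then have "\<forall>x\<in>U. \<exists>u\<in>U. \<forall>z\<in>U. z \<in>\<in> u \<longleftrightarrow> (\<forall>y\<in>U. y \<in>\<in> z \<longrightarrow> y \<in>\<in> x)"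
    unfolding powerset_ax_def sat.simps sat_raw by (simp flip: mem_in_def)
  then show ?thesis using assms by (simp add: sub_def)
qed

lemma emp_ex: "\<exists>u\<in>U. \<forall>z\<in>U. z \<in>\<in> u \<longleftrightarrow> False"
proof -
  obtain x where x: "x \<in> U" using nonempty by blast
  have "dfn1 M (\<lambda>z. False)" unfolding dfn1_def by (rule dfn_const)
  from separation[OF this x] show ?thesis by simp
qed

lemma upair_univ [simp]: "x \<in> U \<Longrightarrow> y \<in> U \<Longrightarrow> upair M x y \<in> U"
  and mem_upair [simp]: "x \<in> U \<Longrightarrow> y \<in> U \<Longrightarrow> z \<in> U \<Longrightarrow> z \<in>\<in> upair M x y \<longleftrightarrow> z = x \<or> z = y"
  unfolding upair_def using the_set[OF upair_ex] by auto

lemma Uni_univ [simp]: "x \<in> U \<Longrightarrow> Uni M x \<in> U"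
  and mem_Uni [simp]: "x \<in> U \<Longrightarrow> z \<in> U \<Longrightarrow> z \<in>\<in> Uni M x \<longleftrightarrow> (\<exists>y\<in>U. z \<in>\<in> y \<and> y \<in>\<in> x)"
  unfolding Uni_def using the_set[OF Uni_ex] by auto

lemma Pw_univ [simp]: "x \<in> U \<Longrightarrow> Pw M x \<in> U"
  and mem_Pw [simp]: "x \<in> U \<Longrightarrow> z \<in> U \<Longrightarrow> z \<in>\<in> Pw M x \<longleftrightarrow> sub M z x"
  unfolding Pw_def using the_set[OF Pw_ex] by auto

lemma emp_univ [simp]: "emp M \<in> U"
  and mem_emp [simp]: "\<not> z \<in>\<in> emp M"
  unfolding emp_def using the_set[OF emp_ex] mem_univ by auto

lemma tm_range: "tm M t \<Longrightarrow> range e \<subseteq> U \<Longrightarrow> t e \<in> U"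
  by (simp add: tm_def)

lemma tm_upair [dfn_intros]:
  assumes "tm M s" "tm M t"
  shows "tm M (\<lambda>e. upair M (s e) (t e))"
  unfolding upair_def
  by (rule tm_the_set)
    (intro upair_ex tm_range[OF assms(1)] tm_range[OF assms(2)] dfn_intros assms[THEN tm_rename_var, of Suc] | assumption)+

lemma tm_Uni [dfn_intros]:
  assumes "tm M s"
  shows "tm M (\<lambda>e. Uni M (s e))"
  unfolding Uni_def
  by (rule tm_the_set)
    (intro Uni_ex tm_range[OF assms(1)] dfn_intros assms[THEN tm_rename_var, of "\<lambda>i. Suc (Suc i)"] | assumption)+

lemma tm_Pw [dfn_intros]:
  assumes "tm M s"
  shows "tm M (\<lambda>e. Pw M (s e))"
  unfolding Pw_def
  by (rule tm_the_set)
    (intro Pw_ex tm_range[OF assms(1)] dfn_intros assms[THEN tm_rename_var, of Suc] | assumption)+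

lemma tm_emp [dfn_intros]: "tm M (\<lambda>e. emp M)"
  by (rule tm_const) simp

lemma tm_pr [dfn_intros]: "tm M s \<Longrightarrow> tm M t \<Longrightarrow> tm M (\<lambda>e. pr M (s e) (t e))"
  unfolding pr_def by (intro dfn_intros)

lemma tm_ins [dfn_intros]: "tm M s \<Longrightarrow> tm M t \<Longrightarrow> tm M (\<lambda>e. ins M (s e) (t e))"
  unfolding ins_def by (intro dfn_intros)

lemma pr_univ [simp]: "x \<in> U \<Longrightarrow> y \<in> U \<Longrightarrow> pr M x y \<in> U"
  by (simp add: pr_def)

lemma ins_univ [simp]: "x \<in> U \<Longrightarrow> y \<in> U \<Longrightarrow> ins M x y \<in> U"
  by (simp add: ins_def)

lemma mem_ins [simp]:
  "x \<in> U \<Longrightarrow> y \<in> U \<Longrightarrow> z \<in> U \<Longrightarrow> z \<in>\<in> ins M x y \<longleftrightarrow> z = x \<or> z \<in>\<in> y"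
  by (simp add: ins_def) (metis mem_upair upair_univ)

lemma upair_eq:
  assumes "a \<in> U" "b \<in> U" "c \<in> U" "d \<in> U"
  shows "upair M a b = upair M c d \<longleftrightarrow> a = c \<and> b = d \<or> a = d \<and> b = c"
proof
  assume "upair M a b = upair M c d"
  then have "z = a \<or> z = b \<longleftrightarrow> z = c \<or> z = d" if "z \<in> U" for z
    using mem_upair[of a b z] mem_upair[of c d z] assms that by simp
  then show "a = c \<and> b = d \<or> a = d \<and> b = c" using assms by metis
next
  assume "a = c \<and> b = d \<or> a = d \<and> b = c"
  then show "upair M a b = upair M c d" using assms by (intro ext) auto
qed

lemma pr_eq [simp]:
  "a \<in> U \<Longrightarrow> b \<in> U \<Longrightarrow> c \<in> U \<Longrightarrow> d \<in> U \<Longrightarrow> pr M a b = pr M c d \<longleftrightarrow> a = c \<and> b = d"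
  unfolding pr_def by (simp add: upair_eq) blast

text \<open>Foundation for the pair of \<open>x\<close> and \<open>y\<close>; the case of equal
  elements excludes self-membership.\<close>

lemma not_mem_cycle: "x \<in>\<in> y \<Longrightarrow> \<not> y \<in>\<in> x"
proof
  assume "x \<in>\<in> y" "y \<in>\<in> x"
  moreover from this have "x \<in> U" "y \<in> U" by (auto dest: mem_univ)
  ultimately show False
    using set_foundation[of "upair M x y" x] by (metis mem_upair upair_univ)
qed

lemma succ_inj: "x \<in> U \<Longrightarrow> y \<in> U \<Longrightarrow> ins M x x = ins M y y \<Longrightarrow> x = y"
  using mem_ins[of x x x] mem_ins[of y y x] mem_ins[of x x y] mem_ins[of y y y] not_mem_cycle
  by metis

lemma succ_neq_emp: "x \<in> U \<Longrightarrow> ins M x x \<noteq> emp M" "x \<in> U \<Longrightarrow> emp M \<noteq> ins M x x"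
  using mem_ins[of x x x] mem_emp by metis+

section \<open>Natural numbers, transitive sets and membership induction\<close>

definition inductive_in :: "'a \<Rightarrow> bool" where
  "inductive_in I \<longleftrightarrow> emp M \<in>\<in> I \<and> (\<forall>x\<in>U. x \<in>\<in> I \<longrightarrow> ins M x x \<in>\<in> I)"

text \<open>These are the natural numbers in the sense of \<open>M\<close>, possibly nonstandard;
  iteration therefore has to be carried out inside \<open>M\<close>, with induction for definable
  classes.\<close>

definition natural :: "'a \<Rightarrow> bool" where
  "natural n \<longleftrightarrow> (\<forall>I\<in>U. inductive_in I \<longrightarrow> n \<in>\<in> I)"

lemma dfn_natural: "dfn1 M natural"
  unfolding dfn1_def natural_def inductive_in_def by (intro dfn_intros)

lemma ex_inductive: "\<exists>I\<in>U. inductive_in I"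
proof -
  obtain x where "x \<in> U" using nonempty by blast
  then have "sat M (\<lambda>_. x) infinity_ax" by (intro axiom) (auto simp: ZF_def)
  then obtain I where I: "I \<in> U" "\<exists>d\<in>U. d \<in>\<in> I \<and> (\<forall>z\<in>U. \<not> z \<in>\<in> d)"
    "\<forall>x\<in>U. x \<in>\<in> I \<longrightarrow> (\<exists>s\<in>U. s \<in>\<in> I \<and> (\<forall>z\<in>U. z \<in>\<in> s \<longleftrightarrow> (\<not> z \<in>\<in> x \<longrightarrow> z = x)))"
    unfolding infinity_ax_def sat.simps sat_raw by (simp flip: mem_in_def) blast
  have "s = ins M x x" if "x \<in> U" "s \<in> U" "\<forall>z\<in>U. z \<in>\<in> s \<longleftrightarrow> (\<not> z \<in>\<in> x \<longrightarrow> z = x)" for x s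
    using that by (intro ext) auto
  moreover have "d = emp M" if "d \<in> U" "\<forall>z\<in>U. \<not> z \<in>\<in> d" for d
    using that by (intro ext) auto
  ultimately have "inductive_in I" unfolding inductive_in_def using I by metis
  then show ?thesis using I by blast
qed

lemma omega_ex: "\<exists>w\<in>U. \<forall>n\<in>U. n \<in>\<in> w \<longleftrightarrow> natural n"
proof -
  obtain I where I: "I \<in> U" "inductive_in I" using ex_inductive by blast
  with separation[OF dfn_natural I(1)] show ?thesis by (auto simp: natural_def)
qed

lemma natural_emp: "natural (emp M)"
  by (simp add: natural_def inductive_in_def)

lemma natural_succ: "n \<in> U \<Longrightarrow> natural n \<Longrightarrow> natural (ins M n n)"
  by (simp add: natural_def inductive_in_def)

lemma natural_induct:
  assumes P: "dfn1 M P" "P (emp M)"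
    "\<And>n. n \<in> U \<Longrightarrow> natural n \<Longrightarrow> P n \<Longrightarrow> P (ins M n n)"
    and n: "n \<in> U" "natural n"
  shows "P n"
proof -
  obtain w where w: "w \<in> U" "\<forall>n\<in>U. n \<in>\<in> w \<longleftrightarrow> natural n" using omega_ex by blast
  from separation[OF P(1) w(1)] w(2) obtain J
    where J: "J \<in> U" "\<forall>n\<in>U. n \<in>\<in> J \<longleftrightarrow> natural n \<and> P n" by auto
  then have "inductive_in J"
    using P(2,3) natural_emp natural_succ by (auto simp: inductive_in_def)
  then show ?thesis using J n by (auto simp: natural_def)
qed

text \<open>
  \<open>iter_Uni x n y\<close> says that \<open>y\<close> is obtained from \<open>{x}\<close> by taking unions \<open>n\<close> times.
\<close>

definition iter_Uni :: "'a \<Rightarrow> 'a \<Rightarrow> 'a \<Rightarrow> bool" where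
  "iter_Uni x n y \<longleftrightarrow> (\<exists>f\<in>U. pr M n y \<in>\<in> f \<and> (\<forall>m\<in>U. \<forall>u\<in>U. pr M m u \<in>\<in> f \<longrightarrow>
     m = emp M \<and> u = upair M x x \<or>
     (\<exists>k\<in>U. \<exists>v\<in>U. pr M k v \<in>\<in> f \<and> m = ins M k k \<and> u = Uni M v)))"

lemma dfn_iter_Uni: "x \<in> U \<Longrightarrow> dfn2 M (iter_Uni x)"
  unfolding dfn2_def iter_Uni_def by (intro dfn_intros)

lemma iter_Uni_cases:
  assumes "iter_Uni x n y" "n \<in> U" "y \<in> U"
  shows "n = emp M \<and> y = upair M x x \<or>
     (\<exists>k\<in>U. \<exists>v\<in>U. iter_Uni x k v \<and> n = ins M k k \<and> y = Uni M v)"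
proof -
  obtain f where f: "f \<in> U" "pr M n y \<in>\<in> f" "\<forall>m\<in>U. \<forall>u\<in>U. pr M m u \<in>\<in> f \<longrightarrow>
     m = emp M \<and> u = upair M x x \<or>
     (\<exists>k\<in>U. \<exists>v\<in>U. pr M k v \<in>\<in> f \<and> m = ins M k k \<and> u = Uni M v)"
    using assms(1) unfolding iter_Uni_def by blast
  then have "iter_Uni x k v" if "pr M k v \<in>\<in> f" for k v
    using that unfolding iter_Uni_def by blast
  then show ?thesis using f(2,3) assms(2,3) by blast
qed

lemma iter_Uni_emp: "x \<in> U \<Longrightarrow> iter_Uni x (emp M) (upair M x x)"
  unfolding iter_Uni_def
  by (rule bexI[of _ "ins M (pr M (emp M) (upair M x x)) (emp M)"]) auto

lemma iter_Uni_succ: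
  assumes "x \<in> U" "n \<in> U" "y \<in> U" "iter_Uni x n y"
  shows "iter_Uni x (ins M n n) (Uni M y)"
proof -
  obtain f where f: "f \<in> U" "pr M n y \<in>\<in> f" "\<forall>m\<in>U. \<forall>u\<in>U. pr M m u \<in>\<in> f \<longrightarrow>
     m = emp M \<and> u = upair M x x \<or>
     (\<exists>k\<in>U. \<exists>v\<in>U. pr M k v \<in>\<in> f \<and> m = ins M k k \<and> u = Uni M v)"
    using assms(4) unfolding iter_Uni_def by blast
  have mem: "pr M k v \<in>\<in> ins M (pr M (ins M n n) (Uni M y)) f \<longleftrightarrow>
      k = ins M n n \<and> v = Uni M y \<or> pr M k v \<in>\<in> f" if "k \<in> U" "v \<in> U" for k v
    using that assms f(1) by simp
  show ?thesis
    unfolding iter_Uni_def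
  proof (intro bexI[of _ "ins M (pr M (ins M n n) (Uni M y)) f"] conjI ballI impI)
    fix m u assume mu: "m \<in> U" "u \<in> U" "pr M m u \<in>\<in> ins M (pr M (ins M n n) (Uni M y)) f"
    show "m = emp M \<and> u = upair M x x \<or> (\<exists>k\<in>U. \<exists>v\<in>U.
        pr M k v \<in>\<in> ins M (pr M (ins M n n) (Uni M y)) f \<and> m = ins M k k \<and> u = Uni M v)"
    proof (cases "pr M m u \<in>\<in> f")
      case True
      then show ?thesis using f(3) mem mu(1,2) by blast
    next
      case False
      then have "m = ins M n n \<and> u = Uni M y" using mem mu by blast
      then show ?thesis using f(2) mem assms(2,3) by blast
    qed
  qed (use assms f(1) in simp_all)
qed

lemma iter_Uni_ex1:
  assumes x: "x \<in> U" and n: "n \<in> U" "natural n"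
  shows "\<exists>y\<in>U. \<forall>y'\<in>U. iter_Uni x n y' \<longleftrightarrow> y' = y"
proof (rule natural_induct[OF _ _ _ n])
  show "dfn1 M (\<lambda>n. \<exists>y\<in>U. \<forall>y'\<in>U. iter_Uni x n y' \<longleftrightarrow> y' = y)"
    unfolding dfn1_def by (intro dfn_intros dfn2_app[OF dfn_iter_Uni[OF x]])
next
  show "\<exists>y\<in>U. \<forall>y'\<in>U. iter_Uni x (emp M) y' \<longleftrightarrow> y' = y"
  proof (rule bexI[of _ "upair M x x"], intro ballI iffI)
    fix y' assume y': "y' \<in> U" "iter_Uni x (emp M) y'"
    from iter_Uni_cases[OF y'(2) _ y'(1)] show "y' = upair M x x"
      by (auto simp: succ_neq_emp(2))
  qed (use x iter_Uni_emp in simp_all)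
next
  fix n assume n: "n \<in> U" "natural n" "\<exists>y\<in>U. \<forall>y'\<in>U. iter_Uni x n y' \<longleftrightarrow> y' = y"
  from n(3) obtain y where y: "y \<in> U" "\<forall>y'\<in>U. iter_Uni x n y' \<longleftrightarrow> y' = y" by (elim bexE)
  show "\<exists>y\<in>U. \<forall>y'\<in>U. iter_Uni x (ins M n n) y' \<longleftrightarrow> y' = y"
  proof (rule bexI[of _ "Uni M y"], intro ballI iffI)
    fix y' assume y': "y' \<in> U" "iter_Uni x (ins M n n) y'"
    from iter_Uni_cases[OF y'(2) _ y'(1)] n(1) succ_neq_emp[OF n(1)]
    obtain k v where kv: "k \<in> U" "v \<in> U" "iter_Uni x k v" "ins M n n = ins M k k" "y' = Uni M v"
      by auto
    then have "k = n" using succ_inj[of n k] n(1) by simp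
    then show "y' = Uni M y" using kv y by simp
  next
    fix y' assume "y' = Uni M y"
    then show "iter_Uni x (ins M n n) y'" using iter_Uni_succ[OF x n(1) y(1)] y by simp
  qed (simp add: y(1))
qed

text \<open>The witness collects all iterated unions of the singleton of \<open>x\<close>. Enclosing
  \<open>x\<close> in a transitive set is what reduces induction and recursion on the whole model to
  sets.\<close>

lemma ex_transitive:
  assumes x: "x \<in> U"
  shows "\<exists>t\<in>U. x \<in>\<in> t \<and> (\<forall>y z. y \<in>\<in> z \<longrightarrow> z \<in>\<in> t \<longrightarrow> y \<in>\<in> t)"
proof -
  obtain w where w: "w \<in> U" "\<forall>n\<in>U. n \<in>\<in> w \<longleftrightarrow> natural n" using omega_ex by blast
  have un: "y = y'" if "n \<in> U" "n \<in>\<in> w" "y \<in> U" "y' \<in> U" "iter_Uni x n y" "iter_Uni x n y'" for n y y'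
  proof -
    have "natural n" using w(2) that(1,2) by simp
    from iter_Uni_ex1[OF x that(1) this] that show ?thesis by (elim bexE) simp
  qed
  have "\<exists>b\<in>U. \<forall>y\<in>U. y \<in>\<in> b \<longleftrightarrow> (\<exists>n\<in>U. n \<in>\<in> w \<and> iter_Uni x n y)"
    by (rule image[OF dfn_iter_Uni[OF x] w(1)]) (rule un)
  then obtain b where b: "b \<in> U" "\<forall>y\<in>U. y \<in>\<in> b \<longleftrightarrow> (\<exists>n\<in>U. n \<in>\<in> w \<and> iter_Uni x n y)"
    by (elim bexE)
  have mem_t: "z \<in>\<in> Uni M b \<longleftrightarrow> (\<exists>n\<in>U. \<exists>y\<in>U. natural n \<and> iter_Uni x n y \<and> z \<in>\<in> y)" if "z \<in> U" for z
    using mem_Uni[OF b(1) that] b(2) w(2) by blast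
  show ?thesis
  proof (intro bexI[of _ "Uni M b"] conjI allI impI)
    show "Uni M b \<in> U" using b by simp
  next
    have "x \<in>\<in> upair M x x" using x by simp
    then show "x \<in>\<in> Uni M b"
      using mem_t[OF x] x natural_emp iter_Uni_emp[OF x] emp_univ upair_univ by blast
  next
    fix y z assume yz: "y \<in>\<in> z" "z \<in>\<in> Uni M b"
    then have U: "y \<in> U" "z \<in> U" by (auto dest: mem_univ)
    then obtain n u where nu: "n \<in> U" "u \<in> U" "natural n" "iter_Uni x n u" "z \<in>\<in> u"
      using mem_t[of z] yz by blast
    then have "y \<in>\<in> Uni M u" using U yz by auto
    then show "y \<in>\<in> Uni M b"
      using mem_t[OF U(1)] natural_succ[OF nu(1,3)] iter_Uni_succ[OF x nu(1,2,4)]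
        ins_univ[OF nu(1,1)] Uni_univ[OF nu(2)] by blast
  qed
qed

text \<open>Foundation speaks of sets only; the counterexamples inside a transitive set containing
  \<open>x\<close> form a set by separation, and a minimal one contradicts
  \<open>step\<close>.\<close>

lemma mem_induct:
  assumes P: "dfn1 M P" and step: "\<And>x. x \<in> U \<Longrightarrow> (\<And>y. y \<in> U \<Longrightarrow> y \<in>\<in> x \<Longrightarrow> P y) \<Longrightarrow> P x"
    and x: "x \<in> U"
  shows "P x"
proof (rule ccontr)
  assume "\<not> P x"
  obtain t where t: "t \<in> U" "x \<in>\<in> t" "\<forall>y z. y \<in>\<in> z \<longrightarrow> z \<in>\<in> t \<longrightarrow> y \<in>\<in> t"
    using ex_transitive[OF x] by blast
  have "dfn1 M (\<lambda>x. \<not> P x)" using P unfolding dfn1_def by (intro dfn_intros)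
  then obtain s where s: "s \<in> U" "\<forall>y\<in>U. y \<in>\<in> s \<longleftrightarrow> y \<in>\<in> t \<and> \<not> P y"
    using separation t(1) by blast
  then have "x \<in>\<in> s" using x t \<open>\<not> P x\<close> by blast
  from set_foundation[OF s(1) x this] obtain m where
    m: "m \<in> U" "m \<in>\<in> s" "\<forall>z\<in>U. z \<in>\<in> s \<longrightarrow> \<not> z \<in>\<in> m" by blast
  have "P m"
  proof (rule step[OF m(1)], rule ccontr)
    fix y assume "y \<in> U" "y \<in>\<in> m" "\<not> P y"
    moreover from this have "y \<in>\<in> t" using t(3) s(2) m(1,2) by blast
    ultimately show False using s(2) m(3) by blast
  qed
  then show False using s(2) m(1,2) by blast
qed

lemma mem_minimal:
  assumes P: "dfn1 M P" and x: "x \<in> U" "P x"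
  obtains m where "m \<in> U" "P m" "\<And>y. y \<in>\<in> m \<Longrightarrow> \<not> P y"
proof (rule ccontr)
  assume "\<not> thesis"
  then have *: "\<exists>y\<in>U. y \<in>\<in> m \<and> P y" if "m \<in> U" "P m" for m
    using that(1,2) \<open>\<And>m. m \<in> U \<Longrightarrow> P m \<Longrightarrow> (\<And>y. y \<in>\<in> m \<Longrightarrow> \<not> P y) \<Longrightarrow> thesis\<close> mem_univ(1) by blast
  have "dfn1 M (\<lambda>x. \<not> P x)" using P unfolding dfn1_def by (intro dfn_intros)
  then have "\<not> P x" by (rule mem_induct) (use * x(1) in blast)+
  with x(2) show False by blast
qed

end

section \<open>Partial recursion along membership\<close>

text \<open>
  \<open>rec_rel M A S Q a y\<close> says that \<open>y\<close> is the element of \<open>(A, S)\<close> whose \<open>S\<close>-predecessors are those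
  \<open>z\<close> for which \<open>Q z w\<close> holds for the value \<open>w\<close> at some member of \<open>a\<close>; there need not be such
  a \<open>y\<close>.  With inclusion for \<open>Q\<close> this is the cumulative hierarchy of \<open>(A, S)\<close>, indexed
  by the elements of \<open>M\<close>; with equality it is the inverse of the Mostowski collapse of \<open>(A, S)\<close>.
\<close>

definition attempt ::
    "(set_pred, 'a) struc \<Rightarrow> 'a set \<Rightarrow> ('a \<Rightarrow> 'a \<Rightarrow> bool) \<Rightarrow> ('a \<Rightarrow> 'a \<Rightarrow> bool) \<Rightarrow> 'a \<Rightarrow> bool" where
  "attempt M A S Q f \<longleftrightarrow> (\<forall>b\<in>univ M. \<forall>u\<in>univ M. pr M b u \<in>\<^bsub>M\<^esub> f \<longrightarrow>
     u \<in> A \<and> (\<forall>c\<in>univ M. c \<in>\<^bsub>M\<^esub> b \<longrightarrow> (\<exists>w\<in>univ M. pr M c w \<in>\<^bsub>M\<^esub> f)) \<and>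
     (\<forall>z\<in>univ M. z \<in> A \<longrightarrow>
       (S z u \<longleftrightarrow> (\<exists>c\<in>univ M. \<exists>w\<in>univ M. c \<in>\<^bsub>M\<^esub> b \<and> pr M c w \<in>\<^bsub>M\<^esub> f \<and> Q z w))))"

definition rec_rel ::
    "(set_pred, 'a) struc \<Rightarrow> 'a set \<Rightarrow> ('a \<Rightarrow> 'a \<Rightarrow> bool) \<Rightarrow> ('a \<Rightarrow> 'a \<Rightarrow> bool) \<Rightarrow> 'a \<Rightarrow> 'a \<Rightarrow> bool" where
  "rec_rel M A S Q a y \<longleftrightarrow> a \<in> univ M \<and> y \<in> univ M \<and>
     (\<exists>f\<in>univ M. attempt M A S Q f \<and> pr M a y \<in>\<^bsub>M\<^esub> f)"

lemma (in zf_model) dfn_univ [dfn_intros]: "tm M t \<Longrightarrow> dfn M (\<lambda>e. t e \<in> U)"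
  by (rule dfn_cong[OF dfn_const[of True]]) (simp add: tm_range)

text \<open>Recursion runs along membership of \<open>M\<close>; extensionality of
  \<open>(A, S)\<close> makes the values unique, while their existence depends on
  \<open>A\<close>.\<close>

locale zf_rec = zf_model +
  fixes A :: "'a set" and S Q :: "'a \<Rightarrow> 'a \<Rightarrow> bool"
  assumes A_subset: "A \<subseteq> U"
    and dfn_A: "dfn1 M (\<lambda>x. x \<in> A)" and dfn_S: "dfn2 M S" and dfn_Q: "dfn2 M Q"
    and ext_A: "\<And>x y. x \<in> A \<Longrightarrow> y \<in> A \<Longrightarrow> (\<And>z. z \<in> A \<Longrightarrow> S z x \<longleftrightarrow> S z y) \<Longrightarrow> x = y"
begin

abbreviation R :: "'a \<Rightarrow> 'a \<Rightarrow> bool" where "R \<equiv> rec_rel M A S Q"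

lemma dfn_R: "dfn2 M R"
  unfolding dfn2_def rec_rel_def attempt_def
  by (intro dfn_intros dfn1_app[OF dfn_A] dfn2_app[OF dfn_S] dfn2_app[OF dfn_Q])

lemma R_univ: "R a y \<Longrightarrow> a \<in> U" "R a y \<Longrightarrow> y \<in> U"
  by (simp_all add: rec_rel_def)

lemma attemptD:
  assumes "attempt M A S Q f" "pr M b u \<in>\<in> f" "b \<in> U" "u \<in> U"
  shows "u \<in> A" "c \<in>\<in> b \<Longrightarrow> \<exists>w\<in>U. pr M c w \<in>\<in> f"
    "z \<in> A \<Longrightarrow> S z u \<longleftrightarrow> (\<exists>c\<in>U. \<exists>w\<in>U. c \<in>\<in> b \<and> pr M c w \<in>\<in> f \<and> Q z w)"
proof -
  note * = assms(1)[unfolded attempt_def, rule_format, OF assms(3,4,2)]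
  show "u \<in> A" using * by blast
  show "\<exists>w\<in>U. pr M c w \<in>\<in> f" if "c \<in>\<in> b" using * that mem_univ(1)[OF that] by blast
  show "S z u \<longleftrightarrow> (\<exists>c\<in>U. \<exists>w\<in>U. c \<in>\<in> b \<and> pr M c w \<in>\<in> f \<and> Q z w)" if "z \<in> A"
    using conjunct2[OF conjunct2[OF *]] that A_subset by blast
qed

lemma R_I: "attempt M A S Q f \<Longrightarrow> f \<in> U \<Longrightarrow> pr M c w \<in>\<in> f \<Longrightarrow> c \<in> U \<Longrightarrow> w \<in> U \<Longrightarrow> R c w"
  by (auto simp: rec_rel_def)

lemma R_unique:
  assumes "R a y" "R a y'"
  shows "y = y'"
proof -
  let ?P = "\<lambda>a. \<forall>y\<in>U. \<forall>y'\<in>U. R a y \<longrightarrow> R a y' \<longrightarrow> y = y'"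
  have "?P a"
  proof (rule mem_induct[OF _ _ R_univ(1)[OF assms(1)]])
    show "dfn1 M ?P" unfolding dfn1_def by (intro dfn_intros dfn2_app[OF dfn_R])
  next
    fix a assume a: "a \<in> U" and IH: "\<And>c. c \<in> U \<Longrightarrow> c \<in>\<in> a \<Longrightarrow> ?P c"
    show "?P a"
    proof (intro ballI impI)
      fix y y' assume y: "y \<in> U" "y' \<in> U" "R a y" "R a y'"
      obtain f where f: "f \<in> U" "attempt M A S Q f" "pr M a y \<in>\<in> f"
        using y(3) by (auto simp: rec_rel_def)
      obtain f' where f': "f' \<in> U" "attempt M A S Q f'" "pr M a y' \<in>\<in> f'"
        using y(4) by (auto simp: rec_rel_def)
      note D = attemptD[OF f(2,3) a y(1)] and D' = attemptD[OF f'(2,3) a y(2)]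
      have same: "pr M c w \<in>\<in> f \<longleftrightarrow> pr M c w \<in>\<in> f'" if c: "c \<in> U" "c \<in>\<in> a" and w: "w \<in> U" for c w
      proof -
        obtain v v' where v: "v \<in> U" "pr M c v \<in>\<in> f" "v' \<in> U" "pr M c v' \<in>\<in> f'"
          using D(2)[OF c(2)] D'(2)[OF c(2)] by blast
        have "v = v'"
          using IH[OF c] v R_I[OF f(2,1) v(2) c(1) v(1)] R_I[OF f'(2,1) v(4) c(1) v(3)] by blast
        moreover have "w = v" if "pr M c w \<in>\<in> f"
          using IH[OF c] v w R_I[OF f(2,1) v(2) c(1) v(1)] R_I[OF f(2,1) that c(1) w] by blast
        moreover have "w = v'" if "pr M c w \<in>\<in> f'"
          using IH[OF c] v w R_I[OF f'(2,1) v(4) c(1) v(3)] R_I[OF f'(2,1) that c(1) w] by blast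
        ultimately show ?thesis using v by blast
      qed
      show "y = y'"
        by (rule ext_A[OF D(1) D'(1)]) (use D(3) D'(3) same in blast)
    qed
  qed
  then show ?thesis using assms R_univ by blast
qed

text \<open>The domain of an attempt is closed under members, and by uniqueness its pairs at members
  of \<open>a\<close> are exactly those of \<open>R\<close>; hence the attempt disappears from the
  recursion equation.\<close>

lemma R_unfold:
  assumes "R a y"
  shows "y \<in> A" "c \<in>\<in> a \<Longrightarrow> \<exists>w. R c w"
    "z \<in> A \<Longrightarrow> S z y \<longleftrightarrow> (\<exists>c w. c \<in>\<in> a \<and> R c w \<and> Q z w)"
proof -
  obtain f where f: "a \<in> U" "y \<in> U" "f \<in> U" "attempt M A S Q f" "pr M a y \<in>\<in> f"
    using assms by (auto simp: rec_rel_def)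
  note D = attemptD[OF f(4,5,1,2)]
  show "y \<in> A" by (rule D(1))
  have R: "R c w" if "pr M c w \<in>\<in> f" "c \<in> U" "w \<in> U" for c w
    using R_I[OF f(4,3) that] .
  show *: "\<exists>w. R c w" if "c \<in>\<in> a" for c
    using D(2)[OF that] R mem_univ(1)[OF that] by blast
  have mem: "pr M c w \<in>\<in> f" if "c \<in>\<in> a" "R c w" for c w
  proof -
    obtain v where "v \<in> U" "pr M c v \<in>\<in> f" using D(2)[OF \<open>c \<in>\<in> a\<close>] by blast
    moreover from this have "v = w" using R_unique R that mem_univ(1) by blast
    ultimately show ?thesis by simp
  qed
  show "S z y \<longleftrightarrow> (\<exists>c w. c \<in>\<in> a \<and> R c w \<and> Q z w)" if "z \<in> A"
    using D(3)[OF that] mem R R_univ by blast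
qed

lemma R_fold:
  assumes a: "a \<in> U" and y: "y \<in> A" and dom: "\<And>c. c \<in>\<in> a \<Longrightarrow> \<exists>w. R c w"
    and S: "\<And>z. z \<in> A \<Longrightarrow> S z y \<longleftrightarrow> (\<exists>c w. c \<in>\<in> a \<and> R c w \<and> Q z w)"
  shows "R a y"
proof (cases "\<exists>y'. R a y'")
  case True
  then obtain y' where y': "R a y'" by blast
  have "y' = y"
    by (rule ext_A) (use R_unfold[OF y'] y S in auto)
  with y' show ?thesis by simp
next
  case False
  obtain t where t: "t \<in> U" "a \<in>\<in> t" "\<forall>y z. y \<in>\<in> z \<longrightarrow> z \<in>\<in> t \<longrightarrow> y \<in>\<in> t"
    using ex_transitive[OF a] by blast
  have yU: "y \<in> U" using y A_subset by blast
  \<comment> \<open>The new attempt consists of all existing values on the transitive set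
    \<open>t\<close>, together with the pair of \<open>a\<close> and \<open>y\<close>. As
    \<open>a\<close> has no value in this case, \<open>?G\<close> is functional and
    \<open>image\<close> applies.\<close>
  let ?G = "\<lambda>b p. \<exists>u\<in>U. p = pr M b u \<and> (R b u \<or> b = a \<and> u = y)"
  have "dfn2 M ?G"
    unfolding dfn2_def by (intro dfn_intros dfn2_app[OF dfn_R] a yU)
  then have "\<exists>f\<in>U. \<forall>p\<in>U. p \<in>\<in> f \<longleftrightarrow> (\<exists>b\<in>U. b \<in>\<in> t \<and> ?G b p)"
  proof (rule image[OF _ t(1)])
    fix b p p' assume "?G b p" "?G b p'"
    then show "p = p'" using R_unique False by blast
  qed
  then obtain f where f: "f \<in> U" "\<forall>p\<in>U. p \<in>\<in> f \<longleftrightarrow> (\<exists>b\<in>U. b \<in>\<in> t \<and> ?G b p)" by blast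
  have mem: "pr M b u \<in>\<in> f \<longleftrightarrow> b \<in>\<in> t \<and> (R b u \<or> b = a \<and> u = y)" if "b \<in> U" "u \<in> U" for b u
    using f(2) that by auto
  have "attempt M A S Q f"
    unfolding attempt_def
  proof (intro ballI impI)
    fix b u assume bu: "b \<in> U" "u \<in> U" "pr M b u \<in>\<in> f"
    then have b: "b \<in>\<in> t" "R b u \<or> b = a \<and> u = y" using mem by auto
    have u: "u \<in> A" using b(2) R_unfold(1) y by blast
    have dom': "\<exists>w. R c w" if "c \<in>\<in> b" for c using b(2) R_unfold(2)[OF _ that] dom that by blast
    have S': "S z u \<longleftrightarrow> (\<exists>c w. c \<in>\<in> b \<and> R c w \<and> Q z w)" if "z \<in> A" for z
      using b(2) R_unfold(3)[OF _ that] S[OF that] by blast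
    have mem': "pr M c w \<in>\<in> f \<longleftrightarrow> R c w" if "c \<in>\<in> b" "w \<in> U" for c w
    proof -
      have "c \<in>\<in> t" "c \<in> U" using t(3) b(1) that mem_univ(1) by blast+
      \<comment> \<open>The members of \<open>b\<close> have values and \<open>a\<close> has none,
        so the added pair does not interfere.\<close>
      moreover have "c \<noteq> a" using dom'[OF that(1)] False by blast
      ultimately show ?thesis using mem that(2) by blast
    qed
    have "\<exists>w\<in>U. pr M c w \<in>\<in> f" if "c \<in>\<in> b" for c
      using dom'[OF that] mem'[OF that] R_univ(2) by blast
    moreover have "S z u \<longleftrightarrow> (\<exists>c\<in>U. \<exists>w\<in>U. c \<in>\<in> b \<and> pr M c w \<in>\<in> f \<and> Q z w)" if "z \<in> A" for z
      unfolding S'[OF that] using mem' R_univ by blast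
    ultimately show "u \<in> A \<and> (\<forall>c\<in>U. c \<in>\<in> b \<longrightarrow> (\<exists>w\<in>U. pr M c w \<in>\<in> f)) \<and> (\<forall>z\<in>U. z \<in> A \<longrightarrow>
        (S z u \<longleftrightarrow> (\<exists>c\<in>U. \<exists>w\<in>U. c \<in>\<in> b \<and> pr M c w \<in>\<in> f \<and> Q z w)))"
      using u by blast
  qed
  moreover have "pr M a y \<in>\<in> f" using mem[OF a yU] t(2) by blast
  ultimately show ?thesis using R_I f(1) a yU by blast
qed

end

section \<open>The cumulative hierarchy\<close>

text \<open>In the usual notation this is the level of the hierarchy at the rank of
  \<open>a\<close>; indexing by arbitrary sets avoids a development of ordinals.\<close>

definition V :: "(set_pred, 'a) struc \<Rightarrow> 'a \<Rightarrow> 'a" where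
  "V M a = (THE y. rec_rel M (univ M) (\<lambda>x y. x \<in>\<^bsub>M\<^esub> y) (sub M) a y)"

context zf_model
begin

lemma zf_rec_V: "zf_rec M U (\<lambda>x y. x \<in>\<in> y) (sub M)"
proof
  show "dfn1 M (\<lambda>x. x \<in> U)" unfolding dfn1_def by (intro dfn_intros)
  show "dfn2 M (\<lambda>x y. x \<in>\<in> y)" "dfn2 M (sub M)" unfolding dfn2_def by (intro dfn_intros)+
qed (auto intro: ext)

interpretation V: zf_rec M U "\<lambda>x y. x \<in>\<in> y" "sub M"
  by (rule zf_rec_V)

text \<open>For the hierarchy of \<open>M\<close> inside \<open>M\<close> the value always exists:
  it is the union of the power sets of the values at the members of \<open>a\<close>, a set by
  replacement.\<close>

lemma V_total: "a \<in> U \<Longrightarrow> \<exists>y\<in>U. V.R a y"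
proof (rule mem_induct)
  show "dfn1 M (\<lambda>a. \<exists>y\<in>U. V.R a y)"
    unfolding dfn1_def by (intro dfn_intros dfn2_app[OF V.dfn_R])
next
  fix a assume a: "a \<in> U" and IH: "\<And>c. c \<in> U \<Longrightarrow> c \<in>\<in> a \<Longrightarrow> \<exists>y\<in>U. V.R c y"
  let ?G = "\<lambda>c p. \<exists>w\<in>U. V.R c w \<and> p = Pw M w"
  have "dfn2 M ?G"
    unfolding dfn2_def by (intro dfn_intros dfn2_app[OF V.dfn_R])
  then have "\<exists>b\<in>U. \<forall>p\<in>U. p \<in>\<in> b \<longleftrightarrow> (\<exists>c\<in>U. c \<in>\<in> a \<and> ?G c p)"
    by (rule image[OF _ a]) (use V.R_unique in blast)
  then obtain b where b: "b \<in> U" "\<forall>p\<in>U. p \<in>\<in> b \<longleftrightarrow> (\<exists>c\<in>U. c \<in>\<in> a \<and> ?G c p)" by blast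
  have "V.R a (Uni M b)"
  proof (rule V.R_fold[OF a])
    fix z assume z: "z \<in> U"
    have "z \<in>\<in> Uni M b \<longleftrightarrow> (\<exists>p\<in>U. z \<in>\<in> p \<and> (\<exists>c\<in>U. c \<in>\<in> a \<and> ?G c p))"
      using mem_Uni[OF b(1) z] b(2) by blast
    also have "\<dots> \<longleftrightarrow> (\<exists>c w. c \<in>\<in> a \<and> V.R c w \<and> sub M z w)"
      using V.R_univ Pw_univ mem_Pw[OF _ z] by blast
    finally show "z \<in>\<in> Uni M b \<longleftrightarrow> (\<exists>c w. c \<in>\<in> a \<and> V.R c w \<and> sub M z w)" .
  next
    show "\<exists>w. V.R c w" if "c \<in>\<in> a" for c using IH[OF mem_univ(1)[OF that] that] by blast
  qed (simp add: b(1))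
  then show "\<exists>y\<in>U. V.R a y" using V.R_univ(2) by blast
qed

lemma V_R: "a \<in> U \<Longrightarrow> V.R a (V M a)"
  unfolding V_def by (rule theI') (use V_total V.R_unique in blast)

lemma V_R_iff: "a \<in> U \<Longrightarrow> V.R a y \<longleftrightarrow> y = V M a"
  using V_R V.R_unique by blast

lemma V_univ [simp]: "a \<in> U \<Longrightarrow> V M a \<in> U"
  using V_R V.R_univ(2) by blast

lemma tm_V [dfn_intros]:
  assumes "tm M t"
  shows "tm M (\<lambda>e. V M (t e))"
proof (rule tm_fun[of _ "\<lambda>e y. V.R (t e) y"])
  show "dfn M (\<lambda>e. V.R (t (\<lambda>i. e (Suc i))) (e 0))"
    by (intro dfn_intros dfn2_app[OF V.dfn_R] tm_rename_var[OF assms, of Suc])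
qed (use assms in \<open>simp_all add: V_R_iff tm_range\<close>)

lemma mem_V:
  assumes "a \<in> U" "z \<in> U"
  shows "z \<in>\<in> V M a \<longleftrightarrow> (\<exists>c. c \<in>\<in> a \<and> sub M z (V M c))"
proof -
  have "V.R c w \<longleftrightarrow> w = V M c" if "c \<in>\<in> a" for c w
    by (rule V_R_iff[OF mem_univ(1)[OF that]])
  then have "(\<exists>c w. c \<in>\<in> a \<and> V.R c w \<and> sub M z w) \<longleftrightarrow> (\<exists>c. c \<in>\<in> a \<and> sub M z (V M c))"
    by (simp cong: conj_cong)
  with V.R_unfold(3)[OF V_R[OF assms(1)] assms(2)] show ?thesis by simp
qed

lemma subI: "(\<And>z. z \<in> U \<Longrightarrow> z \<in>\<in> x \<Longrightarrow> z \<in>\<in> y) \<Longrightarrow> sub M x y"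
  by (simp add: sub_def)

lemma subD: "sub M x y \<Longrightarrow> z \<in>\<in> x \<Longrightarrow> z \<in>\<in> y"
  using mem_univ(1) by (auto simp: sub_def)

lemma sub_V_self: "a \<in> U \<Longrightarrow> sub M a (V M a)"
proof (rule mem_induct[of "\<lambda>a. sub M a (V M a)"])
  show "dfn1 M (\<lambda>a. sub M a (V M a))" unfolding dfn1_def by (intro dfn_intros)
next
  fix x assume x: "x \<in> U" and IH: "\<And>y. y \<in> U \<Longrightarrow> y \<in>\<in> x \<Longrightarrow> sub M y (V M y)"
  show "sub M x (V M x)"
  proof (rule subI)
    fix z assume "z \<in> U" "z \<in>\<in> x"
    then show "z \<in>\<in> V M x" using IH mem_V[OF x] by blast
  qed
qed

text \<open>In terms of ranks: a subset of \<open>V M a\<close> has rank at most that of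
  \<open>a\<close>, so its own level is no larger.\<close>

lemma V_least: "a \<in> U \<Longrightarrow> x \<in> U \<Longrightarrow> sub M x (V M a) \<Longrightarrow> sub M (V M x) (V M a)"
proof -
  let ?P = "\<lambda>a. \<forall>x\<in>U. sub M x (V M a) \<longrightarrow> sub M (V M x) (V M a)"
  have "?P a" if "a \<in> U" for a
  proof (rule mem_induct[OF _ _ that])
    show "dfn1 M ?P" unfolding dfn1_def by (intro dfn_intros)
  next
    fix a assume a: "a \<in> U" and IH: "\<And>d. d \<in> U \<Longrightarrow> d \<in>\<in> a \<Longrightarrow> ?P d"
    show "?P a"
    proof (intro ballI impI subI)
      fix x z assume x: "x \<in> U" "sub M x (V M a)" and z: "z \<in> U" "z \<in>\<in> V M x"
      obtain c where c: "c \<in>\<in> x" "sub M z (V M c)" using mem_V x(1) z by blast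
      then have cU: "c \<in> U" and "c \<in>\<in> V M a" using mem_univ(1) subD[OF x(2)] by blast+
      then obtain d where d: "d \<in>\<in> a" "sub M c (V M d)" using mem_V[OF a] by blast
      then have "sub M (V M c) (V M d)" using IH mem_univ(1) cU by blast
      then have "sub M z (V M d)" using c(2) sub_trans by blast
      then show "z \<in>\<in> V M a" using mem_V[OF a z(1)] d(1) by blast
    qed
  qed
  then show "a \<in> U \<Longrightarrow> x \<in> U \<Longrightarrow> sub M x (V M a) \<Longrightarrow> sub M (V M x) (V M a)" by blast
qed

text \<open>Linearity of ranks. If \<open>z\<close> is included in \<open>V M d\<close> for some
  member \<open>d\<close> of \<open>a\<close>, then some member \<open>y\<close> of \<open>x\<close>
  is outside \<open>V M d\<close>, as \<open>x\<close> is outside \<open>V M a\<close>; the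
  induction hypothesis compares the levels of \<open>d\<close> and \<open>y\<close>.\<close>

lemma V_linear: "a \<in> U \<Longrightarrow> x \<in> U \<Longrightarrow> \<not> x \<in>\<in> V M a \<Longrightarrow> sub M (V M a) (V M x)"
proof -
  let ?P = "\<lambda>a. \<forall>x\<in>U. \<not> x \<in>\<in> V M a \<longrightarrow> sub M (V M a) (V M x)"
  have "?P a" if "a \<in> U" for a
  proof (rule mem_induct[OF _ _ that])
    show "dfn1 M ?P" unfolding dfn1_def by (intro dfn_intros)
  next
    fix a assume a: "a \<in> U" and IH: "\<And>d. d \<in> U \<Longrightarrow> d \<in>\<in> a \<Longrightarrow> ?P d"
    show "?P a"
    proof (intro ballI impI subI)
      fix x z assume x: "x \<in> U" "\<not> x \<in>\<in> V M a" and z: "z \<in> U" "z \<in>\<in> V M a"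
      obtain d where d: "d \<in>\<in> a" "sub M z (V M d)" using mem_V[OF a z(1)] z(2) by blast
      then have "\<not> sub M x (V M d)" using x mem_V[OF a x(1)] by blast
      then obtain y where y: "y \<in> U" "y \<in>\<in> x" "\<not> y \<in>\<in> V M d" by (auto simp: sub_def)
      then have "sub M (V M d) (V M y)" using IH[OF mem_univ(1)[OF d(1)] d(1)] by blast
      then have "sub M z (V M y)" using d(2) sub_trans by blast
      then show "z \<in>\<in> V M x" using mem_V[OF x(1) z(1)] y(2) by blast
    qed
  qed
  then show "a \<in> U \<Longrightarrow> x \<in> U \<Longrightarrow> \<not> x \<in>\<in> V M a \<Longrightarrow> sub M (V M a) (V M x)" by blast
qed

lemma no_universal: "q \<in> U \<Longrightarrow> \<exists>x\<in>U. \<not> x \<in>\<in> q"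
  using not_mem_cycle by blast

text \<open>A strictly increasing map does not lower ranks: every \<open>a\<close> is included in
  the level of its value. A bound \<open>q\<close> on the values would thus put every set into
  \<open>V M q\<close>.\<close>

lemma increasing_unbounded:
  assumes H: "dfn2 M H" and total: "\<And>a. a \<in> U \<Longrightarrow> \<exists>h\<in>U. H a h"
    and mono: "\<And>a b h k. a \<in>\<in> b \<Longrightarrow> H a h \<Longrightarrow> H b k \<Longrightarrow> h \<in>\<in> k"
    and q: "q \<in> U" "\<And>a h. a \<in> U \<Longrightarrow> H a h \<Longrightarrow> h \<in>\<in> q"
  shows False
proof -
  let ?P = "\<lambda>a. \<forall>h\<in>U. H a h \<longrightarrow> sub M a (V M h)"
  have P: "?P a" if "a \<in> U" for a
  proof (rule mem_induct[OF _ _ that])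
    show "dfn1 M ?P" unfolding dfn1_def by (intro dfn_intros dfn2_app[OF H])
  next
    fix a assume a: "a \<in> U" and IH: "\<And>d. d \<in> U \<Longrightarrow> d \<in>\<in> a \<Longrightarrow> ?P d"
    show "?P a"
    proof (intro ballI impI subI)
      fix h b assume h: "h \<in> U" "H a h" and b: "b \<in> U" "b \<in>\<in> a"
      obtain k where k: "k \<in> U" "H b k" using total[OF b(1)] by blast
      then show "b \<in>\<in> V M h" using IH[OF b] mono[OF b(2) k(2) h(2)] mem_V[OF h(1) b(1)] by blast
    qed
  qed
  have "x \<in>\<in> V M q" if x: "x \<in> U" for x
  proof -
    obtain h where "h \<in> U" "H x h" using total[OF x] by blast
    then show ?thesis using P[OF x] q(2)[OF x] mem_V[OF q(1) x] by blast
  qed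
  then show False using no_universal[OF V_univ[OF q(1)]] by blast
qed

end

section \<open>Comparing a model with a definable model\<close>

text \<open>Interpretability enters the comparison only through the transfer of binary relations;
  definability of the universe and of membership of \<open>L\<close> are the special cases
  below.\<close>

locale zf_pair = K: zf_model K + L: zf_model L
  for K L :: "(set_pred, 'a) struc" +
  assumes L_subset: "univ L \<subseteq> univ K"
    and dfn2_transfer:
      "\<And>R. dfn2 L R \<Longrightarrow> dfn2 K (\<lambda>x y. x \<in> univ L \<and> y \<in> univ L \<and> R x y)"
begin

lemma dfn1_transfer: "dfn1 L R \<Longrightarrow> dfn1 K (\<lambda>x. x \<in> univ L \<and> R x)"
proof -
  assume "dfn1 L R"
  then have "dfn2 L (\<lambda>x y. R x)" unfolding dfn1_def dfn2_def .
  from dfn2_app[OF dfn2_transfer[OF this] K.tm_var' K.tm_var', of 0 0]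
  show ?thesis by (simp add: dfn1_def)
qed

lemma dfn_L: "dfn1 K (\<lambda>x. x \<in> univ L)"
  using dfn1_transfer[of "\<lambda>_. True"] L.dfn_const by (simp add: dfn1_def)

lemma dfn_mem_L: "dfn2 K (\<lambda>x y. x \<in>\<^bsub>L\<^esub> y)"
proof -
  have "dfn2 L (\<lambda>x y. x \<in>\<^bsub>L\<^esub> y)" unfolding dfn2_def by (intro dfn_intros L.tm_var')
  moreover have "(x \<in> univ L \<and> y \<in> univ L \<and> x \<in>\<^bsub>L\<^esub> y) = (x \<in>\<^bsub>L\<^esub> y)" for x y
    using L.mem_univ by blast
  ultimately show ?thesis using dfn2_transfer[of "\<lambda>x y. x \<in>\<^bsub>L\<^esub> y"] by simp
qed

lemma dfn_sub_L: "dfn2 K (sub L)"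
proof -
  have "sub L x y \<longleftrightarrow> (\<forall>z\<in>univ K. z \<in>\<^bsub>L\<^esub> x \<longrightarrow> z \<in>\<^bsub>L\<^esub> y)" for x y
    unfolding sub_def using L.mem_univ(1) L_subset by blast
  then have eq: "sub L = (\<lambda>x y. \<forall>z\<in>univ K. z \<in>\<^bsub>L\<^esub> x \<longrightarrow> z \<in>\<^bsub>L\<^esub> y)"
    by (intro HOL.ext)
  show ?thesis
    unfolding dfn2_def eq by (intro dfn_intros dfn2_app[OF dfn_mem_L] K.tm_var')
qed

lemma zf_rec_L: "dfn2 K Q \<Longrightarrow> zf_rec K (univ L) (\<lambda>x y. x \<in>\<^bsub>L\<^esub> y) Q"
  by unfold_locales (use L_subset dfn_L dfn_mem_L L.ext in auto)

sublocale F: zf_rec K "univ L" "\<lambda>x y. x \<in>\<^bsub>L\<^esub> y" "sub L"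
  by (rule zf_rec_L[OF dfn_sub_L])

sublocale T: zf_rec K "univ L" "\<lambda>x y. x \<in>\<^bsub>L\<^esub> y" "(=)"
  by (rule zf_rec_L) (simp add: dfn2_def dfn_eq K.tm_var')

abbreviation F :: "'a \<Rightarrow> 'a \<Rightarrow> bool" where "F \<equiv> F.R"
abbreviation T :: "'a \<Rightarrow> 'a \<Rightarrow> bool" where "T \<equiv> T.R"

text \<open>As a model of ZF, \<open>L\<close> has minimal elements for its own definable classes;
  here they are demanded for all \<open>K\<close>-definable classes.\<close>

definition wf_model :: bool where
  "wf_model \<longleftrightarrow> (\<forall>X x. dfn1 K X \<longrightarrow> x \<in> univ L \<longrightarrow> X x \<longrightarrow>
     (\<exists>m\<in>univ L. X m \<and> (\<forall>y. y \<in>\<^bsub>L\<^esub> m \<longrightarrow> \<not> X y)))"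

section \<open>The hierarchy of \<open>L\<close> indexed by \<open>K\<close>\<close>

lemma F_mem: "c \<in>\<^bsub>K\<^esub> a \<Longrightarrow> F c w \<Longrightarrow> F a y \<Longrightarrow> w \<in>\<^bsub>L\<^esub> y"
  using F.R_unfold(1,3) L.sub_refl by blast

text \<open>A member \<open>u\<close> of \<open>y\<close> is included in an earlier value
  \<open>w\<close>, and \<open>w\<close> is its own level by induction; so \<open>V_least\<close>
  keeps the level of \<open>u\<close> inside \<open>w\<close>.\<close>

lemma F_level:
  assumes "F a y"
  shows "V L y = y"
proof -
  let ?P = "\<lambda>a. \<forall>y\<in>univ K. F a y \<longrightarrow> y \<in> univ L \<and> V L y = y"
  have "dfn1 L (\<lambda>y. V L y = y)" unfolding dfn1_def by (intro dfn_intros L.tm_V L.tm_var')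
  note dfn = dfn1_transfer[OF this]
  have "?P a" if "a \<in> univ K" for a
  proof (rule K.mem_induct[OF _ _ that])
    show "dfn1 K ?P"
      unfolding dfn1_def
      by (intro dfn_intros dfn2_app[OF F.dfn_R] dfn1_app[OF dfn] K.tm_var')
  next
    fix a assume a: "a \<in> univ K" and IH: "\<And>c. c \<in> univ K \<Longrightarrow> c \<in>\<^bsub>K\<^esub> a \<Longrightarrow> ?P c"
    show "?P a"
    proof (intro ballI impI conjI)
      fix y assume y: "F a y"
      note D = F.R_unfold[OF y]
      show yL: "y \<in> univ L" by (rule D(1))
      have lev: "w \<in> univ L" "V L w = w" if "c \<in>\<^bsub>K\<^esub> a" "F c w" for c w
        using IH[OF K.mem_univ(1)[OF that(1)] that(1)] that(2) F.R_univ(2) by blast+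
      have "sub L (V L y) y"
      proof (rule L.subI)
        fix z assume z: "z \<in> univ L" "z \<in>\<^bsub>L\<^esub> V L y"
        then obtain u where u: "u \<in>\<^bsub>L\<^esub> y" "sub L z (V L u)" using L.mem_V[OF yL] by blast
        then have uL: "u \<in> univ L" using L.mem_univ(1) by blast
        then obtain c w where w: "c \<in>\<^bsub>K\<^esub> a" "F c w" "sub L u w" using D(3) u(1) by blast
        then have "sub L (V L u) (V L w)"
          using L.V_least[OF lev(1)[OF w(1,2)] uL] lev(2)[OF w(1,2)] by simp
        then have "sub L z w" using u(2) lev(2)[OF w(1,2)] L.sub_trans by metis
        then show "z \<in>\<^bsub>L\<^esub> y" using D(3)[OF z(1)] w(1,2) by blast
      qed
      then show "V L y = y"
        using L.sub_antisym L.sub_V_self L.V_univ yL by blast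
    qed
  qed
  then show ?thesis using assms F.R_univ by blast
qed

text \<open>An \<open>x\<close> that is not included in the level \<open>w\<close> has larger rank,
  and a member of \<open>x\<close> outside \<open>w\<close> witnesses this.\<close>

lemma not_sub_level:
  assumes "F c w" "x \<in> univ L" "\<not> sub L x w"
  obtains u where "u \<in>\<^bsub>L\<^esub> x" "sub L w (V L u)"
proof -
  obtain u where u: "u \<in> univ L" "u \<in>\<^bsub>L\<^esub> x" "\<not> u \<in>\<^bsub>L\<^esub> w" using assms(3) by (auto simp: sub_def)
  have w: "w \<in> univ L" "V L w = w" using F.R_unfold(1) F_level assms(1) by blast+
  then have "sub L w (V L u)" using L.V_linear[OF w(1) u(1)] u(3) by simp
  then show ?thesis using that u(2) by blast
qed

lemma not_cofinal:
  assumes "F c w" "x \<in> univ L" "\<not> sub L x w"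
  shows "w \<in>\<^bsub>L\<^esub> V L x"
  using not_sub_level[OF assms] L.mem_V[OF assms(2)] F.R_unfold(1)[OF assms(1)] by blast

text \<open>Take a minimal index \<open>a\<close> without a value. If some element of
  \<open>L\<close> were included in no earlier value, then a minimal such \<open>x\<close> would
  make \<open>V L x\<close> satisfy the recursion equation at \<open>a\<close>.\<close>

lemma not_total_cofinal:
  assumes wf: wf_model and a0: "a0 \<in> univ K" "\<not> (\<exists>y. F a0 y)"
  obtains a where "a \<in> univ K"
    "\<And>x. x \<in> univ L \<Longrightarrow> \<exists>c w. c \<in>\<^bsub>K\<^esub> a \<and> F c w \<and> sub L x w"
proof -
  have "dfn1 K (\<lambda>a. \<not> (\<exists>y\<in>univ K. F a y))"
    unfolding dfn1_def by (intro dfn_intros dfn2_app[OF F.dfn_R] K.tm_var')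
  then obtain a where a: "a \<in> univ K" "\<not> (\<exists>y\<in>univ K. F a y)"
    "\<And>c. c \<in>\<^bsub>K\<^esub> a \<Longrightarrow> \<not> \<not> (\<exists>y\<in>univ K. F c y)"
    by (rule K.mem_minimal[OF _ a0(1)]) (use a0(2) in auto)
  let ?X = "\<lambda>x. \<not> (\<exists>c\<in>univ K. \<exists>w\<in>univ K. c \<in>\<^bsub>K\<^esub> a \<and> F c w \<and> sub L x w)"
  have X: "dfn1 K ?X"
    unfolding dfn1_def by (intro dfn_intros dfn2_app[OF F.dfn_R] dfn2_app[OF dfn_sub_L] K.tm_var' a(1))
  have "\<not> ?X x" if "x \<in> univ L" for x
  proof
    assume "?X x"
    with wf X that obtain x where x: "x \<in> univ L" "?X x" "\<forall>u. u \<in>\<^bsub>L\<^esub> x \<longrightarrow> \<not> ?X u"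
      unfolding wf_model_def by blast
    have "F a (V L x)"
    proof (rule F.R_fold[OF a(1)])
      show "V L x \<in> univ L" using x(1) by simp
      show "\<exists>w. F c w" if "c \<in>\<^bsub>K\<^esub> a" for c using a(3)[OF that] by blast
    next
      fix z assume z: "z \<in> univ L"
      show "z \<in>\<^bsub>L\<^esub> V L x \<longleftrightarrow> (\<exists>c w. c \<in>\<^bsub>K\<^esub> a \<and> F c w \<and> sub L z w)"
      proof
        assume "z \<in>\<^bsub>L\<^esub> V L x"
        then obtain u where u: "u \<in>\<^bsub>L\<^esub> x" "sub L z (V L u)" using L.mem_V[OF x(1) z] by blast
        \<comment> \<open>Minimality of \<open>x\<close> places its member \<open>u\<close> inside
          an earlier value.\<close>
        then obtain c w where w: "c \<in>\<^bsub>K\<^esub> a" "F c w" "sub L u w" using x(3) by blast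
        have wL: "w \<in> univ L" "V L w = w" using F.R_unfold(1) F_level w(2) by blast+
        have "sub L (V L u) w" using L.V_least[OF wL(1) L.mem_univ(1)[OF u(1)]] wL(2) w(3) by simp
        then have "sub L z w" using u(2) L.sub_trans by blast
        then show "\<exists>c w. c \<in>\<^bsub>K\<^esub> a \<and> F c w \<and> sub L z w" using w by blast
      next
        assume "\<exists>c w. c \<in>\<^bsub>K\<^esub> a \<and> F c w \<and> sub L z w"
        then obtain c w where w: "c \<in>\<^bsub>K\<^esub> a" "F c w" "sub L z w" by blast
        then have "\<not> sub L x w" using x(2) F.R_univ by blast
        then obtain u where "u \<in>\<^bsub>L\<^esub> x" "sub L w (V L u)" using not_sub_level[OF w(2) x(1)] by blast
        then show "z \<in>\<^bsub>L\<^esub> V L x" using L.mem_V[OF x(1) z] w(3) L.sub_trans by blast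
      qed
    qed
    then show False using a(2) F.R_univ(2) by blast
  qed
  then show ?thesis using that a(1) by blast
qed

section \<open>The inverse collapse from \<open>K\<close> to \<open>L\<close>\<close>

lemma T_mem_level:
  assumes "F c w" "y \<in>\<^bsub>L\<^esub> w"
  obtains c' w' where "c' \<in>\<^bsub>K\<^esub> c" "F c' w'" "sub L y w'"
  using F.R_unfold(3)[OF assms(1) L.mem_univ(1)[OF assms(2)]] assms(2) by blast

text \<open>The preimages of the part of \<open>L\<close> included in the level at \<open>c\<close>
  stay inside one set of \<open>K\<close>, so that separation can collect them.\<close>

lemma T_bound:
  assumes "T b x" "F c w" "sub L x w"
  shows "sub K b (V K c)"
proof -
  let ?P = "\<lambda>b. \<forall>x\<in>univ K. \<forall>c\<in>univ K. \<forall>w\<in>univ K. T b x \<longrightarrow> F c w \<longrightarrow> sub L x w \<longrightarrow> sub K b (V K c)"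
  have "?P b" if "b \<in> univ K" for b
  proof (rule K.mem_induct[OF _ _ that])
    show "dfn1 K ?P"
      unfolding dfn1_def
      by (intro dfn_intros dfn2_app[OF F.dfn_R] dfn2_app[OF T.dfn_R] dfn2_app[OF dfn_sub_L]
          K.tm_var' K.dfn_sub K.tm_V)
  next
    fix b assume b: "b \<in> univ K" and IH: "\<And>d. d \<in> univ K \<Longrightarrow> d \<in>\<^bsub>K\<^esub> b \<Longrightarrow> ?P d"
    show "?P b"
    proof (intro ballI impI K.subI)
      fix x c w d assume *: "T b x" "F c w" "sub L x w" "d \<in> univ K" "d \<in>\<^bsub>K\<^esub> b"
      then obtain y where y: "T d y" using T.R_unfold(2) by blast
      then have "y \<in>\<^bsub>L\<^esub> x" using T.R_unfold(3)[OF *(1)] T.R_unfold(1) *(5) by blast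
      then have "y \<in>\<^bsub>L\<^esub> w" using L.subD[OF *(3)] by blast
      with *(2) obtain c' w' where c': "c' \<in>\<^bsub>K\<^esub> c" "F c' w'" "sub L y w'" by (rule T_mem_level)
      then have "sub K d (V K c')" using IH[OF *(4,5)] y T.R_univ F.R_univ by blast
      then show "d \<in>\<^bsub>K\<^esub> V K c" using K.mem_V c'(1) *(4) F.R_univ(1)[OF *(2)] by blast
    qed
  qed
  then show ?thesis using assms T.R_univ F.R_univ by blast
qed

text \<open>For a minimal \<open>x\<close> outside the range every member has a preimage; cofinality
  and \<open>T_bound\<close> make all these preimages a set \<open>b\<close> of \<open>K\<close>,
  and then \<open>T b x\<close> holds.\<close>

lemma T_surj:
  assumes wf: wf_model and cofinal: "\<And>x. x \<in> univ L \<Longrightarrow> \<exists>c w. F c w \<and> sub L x w"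
    and x: "x \<in> univ L"
  shows "\<exists>b. T b x"
proof -
  let ?X = "\<lambda>x. \<not> (\<exists>b\<in>univ K. T b x)"
  have X: "dfn1 K ?X" unfolding dfn1_def by (intro dfn_intros dfn2_app[OF T.dfn_R] K.tm_var')
  have "\<not> ?X x"
  proof
    assume "?X x"
    with wf X x obtain x where x: "x \<in> univ L" "?X x" "\<forall>u. u \<in>\<^bsub>L\<^esub> x \<longrightarrow> \<not> ?X u"
      unfolding wf_model_def by blast
    obtain c w where w: "F c w" "sub L x w" using cofinal[OF x(1)] by blast
    have cK: "c \<in> univ K" by (rule F.R_univ(1)[OF w(1)])
    have xK: "x \<in> univ K" using x(1) L_subset by blast
    have "dfn1 K (\<lambda>d. \<exists>y\<in>univ K. y \<in>\<^bsub>L\<^esub> x \<and> T d y)"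
      unfolding dfn1_def
      by (intro dfn_intros dfn2_app[OF T.dfn_R] dfn2_app[OF dfn_mem_L] K.tm_var' xK)
    then obtain b where b: "b \<in> univ K"
      "\<forall>d\<in>univ K. d \<in>\<^bsub>K\<^esub> b \<longleftrightarrow> d \<in>\<^bsub>K\<^esub> V K c \<and> (\<exists>y\<in>univ K. y \<in>\<^bsub>L\<^esub> x \<and> T d y)"
      using K.separation K.V_univ[OF cK] by blast
    have mem: "d \<in>\<^bsub>K\<^esub> b" if "y \<in>\<^bsub>L\<^esub> x" "T d y" for d y
    proof -
      have dy: "d \<in> univ K" "y \<in> univ K" using T.R_univ[OF that(2)] .
      have "y \<in>\<^bsub>L\<^esub> w" using L.subD[OF w(2) that(1)] .
      with w(1) obtain c' w' where c': "c' \<in>\<^bsub>K\<^esub> c" "F c' w'" "sub L y w'" by (rule T_mem_level)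
      then have "sub K d (V K c')" using T_bound[OF that(2)] by blast
      then have "d \<in>\<^bsub>K\<^esub> V K c" using K.mem_V[OF cK dy(1)] c'(1) by blast
      then show ?thesis using b(2) dy that by blast
    qed
    have mem': "\<exists>y. y \<in>\<^bsub>L\<^esub> x \<and> T d y" if "d \<in>\<^bsub>K\<^esub> b" for d
      using b(2) K.mem_univ(1)[OF that] that by blast
    have "T b x"
    proof (rule T.R_fold[OF b(1) x(1)])
      fix z assume z: "z \<in> univ L"
      show "z \<in>\<^bsub>L\<^esub> x \<longleftrightarrow> (\<exists>d y. d \<in>\<^bsub>K\<^esub> b \<and> T d y \<and> z = y)"
        using x(3) mem mem' T.R_unique by blast
    qed (use mem' in blast)
    then show False using x(2) b(1) by blast
  qed
  then show ?thesis by blast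
qed

text \<open>If the levels indexed by the members of a single \<open>a\<close> are already cofinal,
  the whole domain of \<open>T\<close> lies in a set of \<open>K\<close>; this is the source of both
  contradictions in the totality proofs.\<close>

lemma T_dom_set:
  assumes "a \<in> univ K" "\<And>x. x \<in> univ L \<Longrightarrow> \<exists>c w. c \<in>\<^bsub>K\<^esub> a \<and> F c w \<and> sub L x w" "T b x"
  shows "b \<in>\<^bsub>K\<^esub> V K a"
proof -
  obtain c w where c: "c \<in>\<^bsub>K\<^esub> a" "F c w" "sub L x w"
    using assms(2) T.R_unfold(1)[OF assms(3)] by blast
  then have "sub K b (V K c)" using T_bound assms(3) by blast
  then show ?thesis using K.mem_V[OF assms(1) T.R_univ(1)[OF assms(3)]] c(1) by blast
qed

end

section \<open>Isomorphic structures\<close>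

text \<open>The condition on relations covers lists of every length, since \<open>sat\<close> also
  evaluates atoms with the wrong number of arguments.\<close>

lemma sat_iso:
  assumes bij: "bij_betw f (univ M) (univ N)"
    and rel: "\<And>P xs. set xs \<subseteq> univ M \<Longrightarrow> map f xs \<in> rel N P \<longleftrightarrow> xs \<in> rel M P"
    and e: "range e \<subseteq> univ M"
  shows "sat N (\<lambda>i. f (e i)) \<phi> \<longleftrightarrow> sat M e \<phi>"
  using e
proof (induction \<phi> arbitrary: e)
  case (Eq x y)
  then have "e x \<in> univ M" "e y \<in> univ M" by auto
  then show ?case using bij inj_on_eq_iff[of f "univ M" "e x" "e y"] by (simp add: bij_betw_def)
next
  case (Atom P xs)
  then have "set (map e xs) \<subseteq> univ M" by auto
  from rel[OF this] show ?case by (simp add: comp_def)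
next
  case (Exists x \<phi>)
  have upd: "(\<lambda>i. f (e i))(x := f a) = (\<lambda>i. f ((e(x := a)) i))" for a by auto
  have "sat N ((\<lambda>i. f (e i))(x := f a)) \<phi> \<longleftrightarrow> sat M (e(x := a)) \<phi>" if "a \<in> univ M" for a
    unfolding upd by (rule Exists.IH) (use Exists.prems that in auto)
  moreover have "univ N = f ` univ M" using bij by (simp add: bij_betw_def)
  ultimately show ?case by simp
qed simp_all

lemma dfn_iso:
  assumes P: "dfn M P" and bij: "bij_betw f (univ M) (univ N)"
    and rel: "\<And>P xs. set xs \<subseteq> univ M \<Longrightarrow> map f xs \<in> rel N P \<longleftrightarrow> xs \<in> rel M P"
  shows "dfn N (\<lambda>e. P (\<lambda>i. inv_into (univ M) f (e i)))"
proof -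
  let ?g = "inv_into (univ M) f"
  obtain \<phi> p where p: "range p \<subseteq> univ M"
    and \<phi>: "\<And>e. range e \<subseteq> univ M \<Longrightarrow> P e = sat M (mix e p) \<phi>"
    using P by (auto simp: dfn_def)
  have fp: "range (\<lambda>i. f (p i)) \<subseteq> univ N" using p bij by (auto simp: bij_betw_def)
  have "P (\<lambda>i. ?g (e i)) = sat N (mix e (\<lambda>i. f (p i))) \<phi>" if e: "range e \<subseteq> univ N" for e
  proof -
    have ge: "range (\<lambda>i. ?g (e i)) \<subseteq> univ M"
      using e bij by (auto simp: bij_betw_def inv_into_into)
    have "f (?g (e i)) = e i" for i
      by (rule f_inv_into_f) (use e bij in \<open>auto simp: bij_betw_def\<close>)
    then have "mix e (\<lambda>i. f (p i)) = (\<lambda>i. f (mix (\<lambda>i. ?g (e i)) p i))"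
      by (auto simp: mix_def fun_eq_iff)
    then show ?thesis
      using \<phi>[OF ge] sat_iso[OF bij rel range_mix[OF ge p]] by simp
  qed
  with fp show ?thesis unfolding dfn_def by blast
qed

section \<open>Solidity for structures on the same type\<close>

locale zf_solid = MN: zf_pair M N + NP: zf_pair N P
  for M N P :: "(set_pred, 'a) struc" +
  fixes i :: "'a \<Rightarrow> 'a"
  assumes bij_i: "bij_betw i (univ M) (univ P)"
    and rel_i: "\<And>R xs. set xs \<subseteq> univ M \<Longrightarrow> map i xs \<in> rel P R \<longleftrightarrow> xs \<in> rel M R"
    and dfn_i: "dfn2 M (\<lambda>x y. y = i x)"
begin

lemma i_P: "x \<in> univ M \<Longrightarrow> i x \<in> univ P"
  using bij_i by (auto simp: bij_betw_def)

lemma i_N: "x \<in> univ M \<Longrightarrow> i x \<in> univ N"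
  using i_P NP.L_subset by blast

lemma N_M: "x \<in> univ N \<Longrightarrow> x \<in> univ M"
  using MN.L_subset by blast

lemma i_M: "x \<in> univ M \<Longrightarrow> i x \<in> univ M"
  using i_N N_M by blast

lemma i_inj: "x \<in> univ M \<Longrightarrow> y \<in> univ M \<Longrightarrow> i x = i y \<Longrightarrow> x = y"
  using bij_i by (auto simp: bij_betw_def inj_on_def)

lemma i_surj: "y \<in> univ P \<Longrightarrow> \<exists>x\<in>univ M. y = i x"
  using bij_i by (auto simp: bij_betw_def)

lemma i_mem: "x \<in> univ M \<Longrightarrow> y \<in> univ M \<Longrightarrow> i x \<in>\<^bsub>P\<^esub> i y \<longleftrightarrow> x \<in>\<^bsub>M\<^esub> y"
  using rel_i[of "[x, y]" Mem] by (simp add: mem_in_def)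

lemma i_mem_surj:
  assumes "y \<in>\<^bsub>P\<^esub> i x" "x \<in> univ M"
  obtains u where "u \<in>\<^bsub>M\<^esub> x" "y = i u"
proof -
  obtain u where "u \<in> univ M" "y = i u" using i_surj NP.L.mem_univ(1)[OF assms(1)] by blast
  then show ?thesis using that i_mem assms by blast
qed

lemma tm_i:
  assumes "tm M t"
  shows "tm M (\<lambda>e. i (t e))"
proof (rule tm_fun[of _ "\<lambda>e y. y = i (t e)"])
  show "dfn M (\<lambda>e. e 0 = i (t (\<lambda>i. e (Suc i))))"
    by (rule dfn2_app[OF dfn_i, of "\<lambda>e. t (\<lambda>i. e (Suc i))" "\<lambda>e. e 0"])
      (intro tm_rename_var[OF assms, of Suc] MN.K.tm_var')+
qed (use assms i_M in \<open>auto simp: tm_def\<close>)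

lemma dfn_NM:
  assumes "dfn2 N R" "\<And>x y. R x y \<Longrightarrow> x \<in> univ N" "\<And>x y. R x y \<Longrightarrow> y \<in> univ N"
  shows "dfn2 M R"
proof -
  have "(\<lambda>x y. x \<in> univ N \<and> y \<in> univ N \<and> R x y) = R" using assms(2,3) by (intro HOL.ext) blast
  with MN.dfn2_transfer[OF assms(1)] show ?thesis by simp
qed

lemmas dfn_F = dfn_NM[OF NP.F.dfn_R NP.F.R_univ]
lemmas dfn_T = dfn_NM[OF NP.T.dfn_R NP.T.R_univ]

lemmas dfn_rules = dfn_intros MN.K.tm_var' MN.K.dfn_const tm_i
  dfn2_app[OF dfn_F] dfn2_app[OF dfn_T] dfn2_app[OF MN.F.dfn_R] dfn2_app[OF MN.T.dfn_R]
  dfn2_app[OF MN.dfn_mem_L] dfn1_app[OF MN.dfn_L]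

section \<open>Well-foundedness and totality of the hierarchies\<close>

lemma wf_NP: "NP.wf_model"
  unfolding NP.wf_model_def
proof (intro allI impI)
  fix X x assume X: "dfn1 N X" and x: "x \<in> univ P" "X x"
  obtain m where m: "m \<in> univ M" "x = i m" using i_surj x(1) by blast
  \<comment> \<open>The class is pulled back along \<open>i\<close>, where membership induction of
    \<open>M\<close> provides a minimal element.\<close>
  have "dfn1 M (\<lambda>m. i m \<in> univ N \<and> X (i m))"
    unfolding dfn1_def
    by (rule dfn1_app[OF MN.dfn1_transfer[OF X], of "\<lambda>e. i (e 0)"]) (intro dfn_rules)
  then obtain m where m: "m \<in> univ M" "i m \<in> univ N \<and> X (i m)"
    "\<And>y. y \<in>\<^bsub>M\<^esub> m \<Longrightarrow> \<not> (i y \<in> univ N \<and> X (i y))"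
    by (rule MN.K.mem_minimal[OF _ m(1)]) (use x m i_N in auto)
  have "\<not> X y" if "y \<in>\<^bsub>P\<^esub> i m" for y
    using that m(1)
  proof (rule i_mem_surj)
    fix u assume "u \<in>\<^bsub>M\<^esub> m" "y = i u"
    then show "\<not> X y" using m(3) i_N MN.K.mem_univ(1) by blast
  qed
  then show "\<exists>m\<in>univ P. X m \<and> (\<forall>y. y \<in>\<^bsub>P\<^esub> m \<longrightarrow> \<not> X y)" using m(1,2) i_P by blast
qed

text \<open>
  If the hierarchy of \<open>P\<close> did not reach all indices in \<open>N\<close>, then \<open>P\<close> would be a set for \<open>N\<close>, so every
  \<open>M\<close>-definable class would be coded by an element of \<open>N\<close>, and thus of \<open>M\<close>: diagonalise.
\<close>

lemma NP_total:
  assumes "n \<in> univ N"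
  shows "\<exists>y. NP.F n y"
proof (rule ccontr)
  assume "\<not> (\<exists>y. NP.F n y)"
  from NP.not_total_cofinal[OF wf_NP assms this] obtain a where a: "a \<in> univ N"
    "\<And>x. x \<in> univ P \<Longrightarrow> \<exists>c w. c \<in>\<^bsub>N\<^esub> a \<and> NP.F c w \<and> sub P x w" by metis
  have surj: "\<exists>b. NP.T b x" if "x \<in> univ P" for x
    by (rule NP.T_surj[OF wf_NP _ that]) (use a(2) in blast)
  have dom: "b \<in>\<^bsub>N\<^esub> V N a" if "NP.T b x" for b x
    by (rule NP.T_dom_set[OF a(1) _ that]) (rule a(2))
  \<comment> \<open>The diagonal class: a code of \<open>x\<close> is a preimage of
    \<open>i x\<close> under \<open>NP.T\<close>, and \<open>?X\<close> holds of those
    \<open>x\<close> that contain, in the sense of \<open>N\<close>, none of their codes.\<close>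
  let ?X = "\<lambda>x. \<not> (\<exists>n\<in>univ M. NP.T n (i x) \<and> n \<in>\<^bsub>N\<^esub> x)"
  let ?j = "inv_into (univ M) i"
  have "dfn1 M ?X" unfolding dfn1_def by (intro dfn_rules)
  then have "dfn1 P (\<lambda>y. ?X (?j y))"
    unfolding dfn1_def by (rule dfn_iso[OF _ bij_i rel_i])
  then have Xj: "dfn1 N (\<lambda>y. y \<in> univ P \<and> ?X (?j y))" by (rule NP.dfn1_transfer)
  \<comment> \<open>The \<open>M\<close>-definable class moves along \<open>i\<close> to a
    \<open>P\<close>-definable one, hence to an \<open>N\<close>-definable one. All codes lie in
    \<open>V N a\<close>, so the codes of its elements form a set \<open>s\<close> of
    \<open>N\<close>.\<close>
  have "dfn1 N (\<lambda>n. \<exists>y\<in>univ N. NP.T n y \<and> y \<in> univ P \<and> ?X (?j y))"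
    unfolding dfn1_def
    by (intro dfn_ex dfn_conj[OF dfn2_app[OF NP.T.dfn_R] dfn1_app[OF Xj]] MN.L.tm_var')
  from MN.L.separation[OF this MN.L.V_univ[OF a(1)]] obtain s where s: "s \<in> univ N"
    "\<forall>n\<in>univ N. n \<in>\<^bsub>N\<^esub> s \<longleftrightarrow> n \<in>\<^bsub>N\<^esub> V N a \<and> (\<exists>y\<in>univ N. NP.T n y \<and> y \<in> univ P \<and> ?X (?j y))"
    by blast
  have sM: "s \<in> univ M" using s(1) N_M by blast
  have js: "?j (i s) = s" using bij_i sM by (auto simp: bij_betw_def)
  obtain n0 where n0: "NP.T n0 (i s)" using surj i_P sM by blast
  have key: "n \<in>\<^bsub>N\<^esub> s \<longleftrightarrow> ?X s" if n: "NP.T n (i s)" for n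
  proof -
    have "n \<in>\<^bsub>N\<^esub> s \<longleftrightarrow> (\<exists>y\<in>univ N. NP.T n y \<and> y \<in> univ P \<and> ?X (?j y))"
      using s(2) NP.T.R_univ(1)[OF n] dom[OF n] by simp
    also have "\<dots> \<longleftrightarrow> ?X (?j (i s))"
      using NP.T.R_unique[OF n] n i_P[OF sM] i_N[OF sM] by metis
    finally show ?thesis by (simp only: js)
  qed
  \<comment> \<open>Every code of \<open>s\<close> belongs to \<open>s\<close> exactly if
    \<open>?X s\<close>, and a code exists; by definition \<open>?X s\<close> says that no code
    belongs to \<open>s\<close>.\<close>
  have "?X s \<longleftrightarrow> \<not> ?X s"
    using key n0 NP.T.R_univ(1) N_M by metis
  then show False by blast
qed

lemma NP_total_i:
  assumes "n \<in> univ N"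
  obtains h where "h \<in> univ M" "NP.F n (i h)"
  using NP_total[OF assms] NP.F.R_unfold(1) i_surj by metis

text \<open>\<open>NP.F\<close> followed by the inverse of \<open>i\<close> is a total map from
  \<open>N\<close> to \<open>M\<close> preserving membership. A minimal element of the image of
  \<open>X\<close> therefore comes from a minimal element of \<open>X\<close>.\<close>

lemma wf_MN: "MN.wf_model"
  unfolding MN.wf_model_def
proof (intro allI impI)
  fix X x assume X: "dfn1 M X" and x: "x \<in> univ N" "X x"
  let ?Y = "\<lambda>m. \<exists>n\<in>univ M. X n \<and> NP.F n (i m)"
  have Y: "dfn1 M ?Y" unfolding dfn1_def by (intro dfn_rules dfn1_app[OF X])
  obtain h where h: "h \<in> univ M" "NP.F x (i h)" by (rule NP_total_i[OF x(1)])
  then have "?Y h" using x N_M by blast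
  from MN.K.mem_minimal[OF Y h(1) this] obtain m where m: "m \<in> univ M" "?Y m"
    "\<And>y. y \<in>\<^bsub>M\<^esub> m \<Longrightarrow> \<not> ?Y y" by metis
  then obtain n where n: "X n" "NP.F n (i m)" by blast
  have "\<not> X n'" if n': "n' \<in>\<^bsub>N\<^esub> n" for n'
  proof
    assume "X n'"
    have n'N: "n' \<in> univ N" using MN.L.mem_univ(1)[OF n'] .
    obtain h where h: "h \<in> univ M" "NP.F n' (i h)" by (rule NP_total_i[OF n'N])
    then have "i h \<in>\<^bsub>P\<^esub> i m" using NP.F_mem[OF n'] n(2) by blast
    then have "h \<in>\<^bsub>M\<^esub> m" using i_mem h(1) m(1) by blast
    with m(3) h(2) \<open>X n'\<close> N_M[OF n'N] show False by blast
  qed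
  then show "\<exists>m\<in>univ N. X m \<and> (\<forall>y. y \<in>\<^bsub>N\<^esub> m \<longrightarrow> \<not> X y)"
    using n NP.F.R_univ(1) by blast
qed

text \<open>If the hierarchy of \<open>N\<close> did not reach all indices in \<open>M\<close>, then \<open>M\<close> would inject into a set.\<close>

lemma MN_total:
  assumes "x \<in> univ M"
  shows "\<exists>y. MN.F x y"
proof (rule ccontr)
  assume "\<not> (\<exists>y. MN.F x y)"
  from MN.not_total_cofinal[OF wf_MN assms this] obtain a where a: "a \<in> univ M"
    "\<And>x. x \<in> univ N \<Longrightarrow> \<exists>c w. c \<in>\<^bsub>M\<^esub> a \<and> MN.F c w \<and> sub N x w" by metis
  have surj: "\<exists>b. MN.T b x" if "x \<in> univ N" for x
    by (rule MN.T_surj[OF wf_MN _ that]) (use a(2) in blast)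
  have dom: "b \<in>\<^bsub>M\<^esub> V M a" if "MN.T b x" for b x
    by (rule MN.T_dom_set[OF a(1) _ that]) (rule a(2))
  \<comment> \<open>Injectivity of \<open>i\<close> makes this relation functional, and every
    \<open>m\<close> is a value because \<open>i m\<close> has a preimage in \<open>V M a\<close>;
    its image \<open>q\<close> would be a universal set.\<close>
  have "dfn2 M (\<lambda>b m. MN.T b (i m))" unfolding dfn2_def by (intro dfn_rules)
  then have "\<exists>q\<in>univ M. \<forall>m\<in>univ M. m \<in>\<^bsub>M\<^esub> q \<longleftrightarrow> (\<exists>b\<in>univ M. b \<in>\<^bsub>M\<^esub> V M a \<and> MN.T b (i m))"
    by (rule MN.K.image[OF _ MN.K.V_univ[OF a(1)]]) (use MN.T.R_unique i_inj in blast)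
  then obtain q where q: "q \<in> univ M"
    "\<forall>m\<in>univ M. m \<in>\<^bsub>M\<^esub> q \<longleftrightarrow> (\<exists>b\<in>univ M. b \<in>\<^bsub>M\<^esub> V M a \<and> MN.T b (i m))" by blast
  have "m \<in>\<^bsub>M\<^esub> q" if m: "m \<in> univ M" for m
  proof -
    obtain b where "MN.T b (i m)" using surj[OF i_N[OF m]] by blast
    then show ?thesis using q(2) m dom MN.T.R_univ(1) by blast
  qed
  with MN.K.no_universal[OF q(1)] show False by blast
qed

section \<open>Cofinality of the hierarchies\<close>

lemma H_bounded:
  assumes q: "q \<in> univ M" "\<And>a n h. MN.F a n \<Longrightarrow> NP.F n (i h) \<Longrightarrow> h \<in> univ M \<Longrightarrow> h \<in>\<^bsub>M\<^esub> q"
  shows False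
proof -
  \<comment> \<open>The composite of the two hierarchies with the inverse of \<open>i\<close> is
    total and strictly increasing on \<open>M\<close>.\<close>
  let ?H = "\<lambda>a h. h \<in> univ M \<and> (\<exists>n\<in>univ M. MN.F a n \<and> NP.F n (i h))"
  have "dfn2 M ?H" unfolding dfn2_def by (intro dfn_rules MN.K.dfn_univ)
  then show False
  proof (rule MN.K.increasing_unbounded[of ?H, OF _ _ _ q(1)])
    fix a assume "a \<in> univ M"
    then obtain n where n: "MN.F a n" using MN_total by blast
    then have nN: "n \<in> univ N" by (rule MN.F.R_unfold(1))
    obtain h where "h \<in> univ M" "NP.F n (i h)" by (rule NP_total_i[OF nN])
    then show "\<exists>h\<in>univ M. ?H a h" using n N_M[OF nN] by blast
  next
    fix a b h k assume ab: "a \<in>\<^bsub>M\<^esub> b" and h: "?H a h" and k: "?H b k"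
    obtain n m where "MN.F a n" "NP.F n (i h)" "MN.F b m" "NP.F m (i k)" using h k by blast
    then have "i h \<in>\<^bsub>P\<^esub> i k" using MN.F_mem[OF ab] NP.F_mem by blast
    then show "h \<in>\<^bsub>M\<^esub> k" using i_mem h k by blast
  qed (use q(2) in blast)
qed

text \<open>Otherwise all values of \<open>MN.F\<close> lie in \<open>V N x\<close>, and the value
  of \<open>NP.F\<close> at \<open>V N x\<close> bounds the composite.\<close>

lemma MN_cofinal:
  assumes x: "x \<in> univ N"
  shows "\<exists>c w. MN.F c w \<and> sub N x w"
proof (rule ccontr)
  assume *: "\<not> (\<exists>c w. MN.F c w \<and> sub N x w)"
  have "V N x \<in> univ N" using x by simp
  then obtain q where q: "q \<in> univ M" "NP.F (V N x) (i q)" by (rule NP_total_i)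
  show False
  proof (rule H_bounded[OF q(1)])
    fix a n h assume n: "MN.F a n" "NP.F n (i h)" and h: "h \<in> univ M"
    then have "n \<in>\<^bsub>N\<^esub> V N x" using MN.not_cofinal[OF n(1) x] * by blast
    then have "i h \<in>\<^bsub>P\<^esub> i q" using NP.F_mem n(2) q(2) by blast
    then show "h \<in>\<^bsub>M\<^esub> q" using i_mem h q(1) by blast
  qed
qed

text \<open>Here \<open>V P x\<close> itself, read back through \<open>i\<close>, bounds the
  composite.\<close>

lemma NP_cofinal:
  assumes x: "x \<in> univ P"
  shows "\<exists>c w. NP.F c w \<and> sub P x w"
proof (rule ccontr)
  assume *: "\<not> (\<exists>c w. NP.F c w \<and> sub P x w)"
  have "V P x \<in> univ P" using x by simp
  then obtain q where q: "q \<in> univ M" "V P x = i q" using i_surj by blast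
  show False
  proof (rule H_bounded[OF q(1)])
    fix a n h assume n: "MN.F a n" "NP.F n (i h)" and h: "h \<in> univ M"
    then have "i h \<in>\<^bsub>P\<^esub> i q" using NP.not_cofinal[OF n(2) x] * q(2) by auto
    then show "h \<in>\<^bsub>M\<^esub> q" using i_mem h q(1) by blast
  qed
qed

section \<open>The collapse maps and the isomorphism\<close>

lemma T_T_id:
  assumes "MN.T a n" "NP.T n (i b)" "b \<in> univ M"
  shows "a = b"
proof -
  let ?P = "\<lambda>a. \<forall>b\<in>univ M. \<forall>n\<in>univ M. MN.T a n \<longrightarrow> NP.T n (i b) \<longrightarrow> a = b"
  have "?P a"
  proof (rule MN.K.mem_induct[OF _ _ MN.T.R_univ(1)[OF assms(1)]])
    show "dfn1 M ?P" unfolding dfn1_def by (intro dfn_rules)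
  next
    fix a assume a: "a \<in> univ M" and IH: "\<And>c. c \<in> univ M \<Longrightarrow> c \<in>\<^bsub>M\<^esub> a \<Longrightarrow> ?P c"
    show "?P a"
    proof (intro ballI impI)
      fix b n assume b: "b \<in> univ M" and n: "MN.T a n" "NP.T n (i b)"
      show "a = b"
      \<comment> \<open>Both collapse maps and \<open>i\<close> match the members of an element with
        those of its image, so the members of \<open>a\<close> and \<open>b\<close> correspond; by
        induction corresponding members are equal.\<close>
      proof (rule MN.K.ext[OF a b], rule iffI)
        fix c assume c: "c \<in> univ M" "c \<in>\<^bsub>M\<^esub> a"
        obtain m where m: "MN.T c m" using MN.T.R_unfold(2)[OF n(1) c(2)] by blast
        then have mn: "m \<in>\<^bsub>N\<^esub> n"
          using MN.T.R_unfold(3)[OF n(1) MN.T.R_unfold(1)[OF m]] c(2) by blast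
        obtain w where w: "NP.T m w" using NP.T.R_unfold(2)[OF n(2) mn] by blast
        then have "w \<in>\<^bsub>P\<^esub> i b"
          using NP.T.R_unfold(3)[OF n(2) NP.T.R_unfold(1)[OF w]] mn by blast
        then obtain d where d: "d \<in>\<^bsub>M\<^esub> b" "w = i d" using b by (rule i_mem_surj)
        then have "c = d"
          using IH[OF c] m w MN.T.R_univ(2)[OF m] MN.K.mem_univ(1)[OF d(1)] by blast
        with d(1) show "c \<in>\<^bsub>M\<^esub> b" by simp
      next
        fix d assume d: "d \<in> univ M" "d \<in>\<^bsub>M\<^esub> b"
        then have "i d \<in>\<^bsub>P\<^esub> i b" using i_mem b by blast
        then obtain m where m: "m \<in>\<^bsub>N\<^esub> n" "NP.T m (i d)"
          using NP.T.R_unfold(3)[OF n(2) i_P[OF d(1)]] by blast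
        then obtain c where c: "c \<in>\<^bsub>M\<^esub> a" "MN.T c m"
          using MN.T.R_unfold(3)[OF n(1) MN.L.mem_univ(1)[OF m(1)]] by blast
        then have "c = d"
          using IH[OF MN.K.mem_univ(1)[OF c(1)] c(1)] m d(1) MN.T.R_univ(2)[OF c(2)] by blast
        with c(1) show "d \<in>\<^bsub>M\<^esub> a" by simp
      qed
    qed
  qed
  then show ?thesis using assms MN.T.R_univ(2) by blast
qed

lemma MN_T_surj: "n \<in> univ N \<Longrightarrow> \<exists>a. MN.T a n"
  by (rule MN.T_surj[OF wf_MN MN_cofinal])

text \<open>Totality of \<open>MN.T\<close> comes from surjectivity: going back from
  \<open>i b\<close> through \<open>N\<close> to \<open>M\<close> arrives at some \<open>a\<close>,
  which is \<open>b\<close> by \<open>T_T_id\<close>.\<close>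

lemma T_value:
  assumes b: "b \<in> univ M"
  obtains n where "MN.T b n" "NP.T n (i b)"
proof -
  obtain n where n: "NP.T n (i b)" using NP.T_surj[OF wf_NP NP_cofinal i_P[OF b]] by blast
  obtain a where a: "MN.T a n" using MN_T_surj[OF NP.T.R_univ(1)[OF n]] by blast
  have "a = b" by (rule T_T_id[OF a n b])
  then show ?thesis using that a n by blast
qed

text \<open>By \<open>T_value\<close> the common value \<open>n\<close> is sent to
  \<open>i b\<close> by \<open>NP.T\<close>, and \<open>T_T_id\<close> applies to
  \<open>a\<close>.\<close>

lemma T_inj:
  assumes "MN.T a n" "MN.T b n"
  shows "a = b"
proof -
  have ab: "a \<in> univ M" "b \<in> univ M" using assms MN.T.R_univ(1) by blast+
  obtain m where m: "MN.T b m" "NP.T m (i b)" by (rule T_value[OF ab(2)])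
  then have "NP.T n (i b)" using MN.T.R_unique[OF assms(2) m(1)] by simp
  with assms(1) show ?thesis using ab(2) by (rule T_T_id)
qed

theorem ex_definable_isomorphism:
  obtains t where "bij_betw t (univ M) (univ N)"
    "\<And>x y. x \<in> univ M \<Longrightarrow> y \<in> univ M \<Longrightarrow> x \<in>\<^bsub>M\<^esub> y \<longleftrightarrow> t x \<in>\<^bsub>N\<^esub> t y"
    "dfn2 M (\<lambda>x y. x \<in> univ M \<and> y = t x)"
proof -
  define t where "t a = (THE n. MN.T a n)" for a
  have t: "MN.T a (t a)" if "a \<in> univ M" for a
    unfolding t_def
    by (rule theI') (use T_value[OF that] MN.T.R_unique in metis)
  have T_iff: "MN.T a n \<longleftrightarrow> a \<in> univ M \<and> n = t a" for a n
    using t MN.T.R_unique MN.T.R_univ(1) by metis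
  have tN: "t a \<in> univ N" if "a \<in> univ M" for a using MN.T.R_unfold(1)[OF t[OF that]] .
  show ?thesis
  proof (rule that)
    show "bij_betw t (univ M) (univ N)"
      unfolding bij_betw_def
    proof
      show "inj_on t (univ M)" using T_inj t by (metis inj_onI)
      show "t ` univ M = univ N"
      proof (intro equalityI subsetI)
        fix n assume "n \<in> univ N"
        then obtain a where "MN.T a n" using MN_T_surj by blast
        then show "n \<in> t ` univ M" using T_iff by blast
      qed (use tN in blast)
    qed
  next
    fix x y assume xy: "x \<in> univ M" "y \<in> univ M"
    have "t x \<in>\<^bsub>N\<^esub> t y \<longleftrightarrow> (\<exists>c w. c \<in>\<^bsub>M\<^esub> y \<and> MN.T c w \<and> t x = w)"
      by (rule MN.T.R_unfold(3)[OF t[OF xy(2)] tN[OF xy(1)]])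
    also have "\<dots> \<longleftrightarrow> x \<in>\<^bsub>M\<^esub> y" using T_inj[OF _ t[OF xy(1)]] t[OF xy(1)] by metis
    finally show "x \<in>\<^bsub>M\<^esub> y \<longleftrightarrow> t x \<in>\<^bsub>N\<^esub> t y" by simp
  next
    have "MN.T = (\<lambda>x y. x \<in> univ M \<and> y = t x)" using T_iff by (intro HOL.ext)
    with MN.T.dfn_R show "dfn2 M (\<lambda>x y. x \<in> univ M \<and> y = t x)" by simp
  qed
qed

end

section \<open>Structures on tuples\<close>

text \<open>As rewrite rules these loop once \<open>nlists_def\<close> is unfolded.\<close>

declare nlistsE_set [simp del] nlistsE_length [simp del]

section \<open>Copies of structures along injections\<close>

definition push :: "('a \<Rightarrow> 'b) \<Rightarrow> ('p, 'a) struc \<Rightarrow> ('p, 'b) struc" where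
  "push f S = \<lparr>univ = f ` univ S, rel = \<lambda>P. map f ` rel S P\<rparr>"

lemma univ_push [simp]: "univ (push f S) = f ` univ S"
  by (simp add: push_def)

lemma rel_nlists: "is_struc ar S \<Longrightarrow> xs \<in> rel S P \<Longrightarrow> xs \<in> nlists (ar P) (univ S)"
  unfolding is_struc_def by blast

lemma rel_push:
  assumes S: "is_struc ar S" and f: "inj_on f (univ S)" and xs: "set xs \<subseteq> univ S"
  shows "map f xs \<in> rel (push f S) P \<longleftrightarrow> xs \<in> rel S P"
proof
  assume "map f xs \<in> rel (push f S) P"
  then obtain ys where ys: "ys \<in> rel S P" "map f xs = map f ys" by (auto simp: push_def)
  have "set ys \<subseteq> univ S" by (rule nlistsE_set[OF rel_nlists[OF S ys(1)]])
  then have "xs = ys" using xs by (intro map_inj_on[OF ys(2)] inj_on_subset[OF f]) simp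
  with ys(1) show "xs \<in> rel S P" by simp
qed (simp add: push_def)

lemma bij_push: "inj_on f (univ S) \<Longrightarrow> bij_betw f (univ S) (univ (push f S))"
  by (simp add: inj_on_imp_bij_betw)

lemma models_push:
  assumes S: "models ar S T" and f: "inj_on f (univ S)"
  shows "models ar (push f S) T"
proof -
  have st: "is_struc ar S" using S by (simp add: models_def)
  have "is_struc ar (push f S)"
    unfolding is_struc_def
  proof (intro conjI allI subsetI)
    show "univ (push f S) \<noteq> {}" using st by (simp add: is_struc_def)
  next
    fix P ys assume "ys \<in> rel (push f S) P"
    then obtain xs where xs: "xs \<in> rel S P" "ys = map f xs" by (auto simp: push_def)
    show "ys \<in> nlists (ar P) (univ (push f S))"
      using rel_nlists[OF st xs(1)] by (simp add: xs(2) nlists_def image_mono)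
  qed
  moreover have "sat (push f S) e \<phi>" if \<phi>: "\<phi> \<in> T" and e: "range e \<subseteq> univ (push f S)" for \<phi> e
  proof -
    let ?e = "\<lambda>i. inv_into (univ S) f (e i)"
    have e': "range ?e \<subseteq> univ S" using e by (auto simp: inv_into_into)
    have "(\<lambda>i. f (?e i)) = e" using e by (intro ext f_inv_into_f) auto
    with sat_iso[OF bij_push[OF f] rel_push[OF st f] e', of \<phi>] S \<phi> e'
    show ?thesis by (simp add: models_def)
  qed
  ultimately show ?thesis by (simp add: models_def)
qed

lemma definable_push:
  assumes S: "is_struc ar S" and f: "inj_on f (univ S)" and X: "definable S X"
  shows "definable (push f S) (map f ` X)"
proof -
  obtain n \<phi> e where e: "range e \<subseteq> univ S"
    and X: "X = {xs \<in> nlists n (univ S). sat S (\<lambda>i. if i < n then xs ! i else e i) \<phi>}"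
    using X by (auto simp: definable_def)
  have sat: "sat (push f S) (\<lambda>i. if i < n then map f xs ! i else f (e i)) \<phi> \<longleftrightarrow>
      sat S (\<lambda>i. if i < n then xs ! i else e i) \<phi>" if "xs \<in> nlists n (univ S)" for xs
  proof -
    have "range (\<lambda>i. if i < n then xs ! i else e i) \<subseteq> univ S"
      using e that by (auto simp: nlists_def)
    note * = sat_iso[OF bij_push[OF f] rel_push[OF S f] this, of \<phi>]
    have "(\<lambda>i. f (if i < n then xs ! i else e i)) = (\<lambda>i. if i < n then map f xs ! i else f (e i))"
      using that by (auto simp: nlists_def fun_eq_iff)
    with * show ?thesis by simp
  qed
  have "\<exists>xs. ys = map f xs \<and> xs \<in> nlists n (univ S)" if "ys \<in> nlists n (univ (push f S))" for ys
    using that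
    by (intro exI[of _ "map (inv_into (univ S) f) ys"])
      (auto simp: nlists_def f_inv_into_f subset_iff inv_into_into intro!: map_idI[symmetric])
  moreover have "map f xs \<in> nlists n (univ (push f S))" if "xs \<in> nlists n (univ S)" for xs
    using that by (auto simp: nlists_def)
  ultimately have "map f ` X = {ys \<in> nlists n (univ (push f S)).
      sat (push f S) (\<lambda>i. if i < n then ys ! i else f (e i)) \<phi>}"
    unfolding X using sat by blast
  moreover have "range (\<lambda>i. f (e i)) \<subseteq> univ (push f S)" using e by auto
  ultimately show ?thesis unfolding definable_def by blast
qed

lemma definable_subset: "definable M X \<Longrightarrow> \<exists>n. X \<subseteq> nlists n (univ M)"
  unfolding definable_def by blast

text \<open>The elements of \<open>L\<close> are tuples over \<open>S\<close>, so replacing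
  \<open>S\<close> by a copy changes them componentwise.\<close>

lemma interprets_push:
  assumes S: "is_struc ar S" and f: "inj_on f (univ S)" and "S \<unrhd>\<^sub>p\<^sub>a\<^sub>r L"
  shows "push f S \<unrhd>\<^sub>p\<^sub>a\<^sub>r push (map f) L"
proof -
  have "concat ` rel (push (map f) L) P = map f ` concat ` rel L P" for P
    by (simp add: push_def image_image map_concat)
  then show ?thesis
    using assms(3) definable_push[OF S f] by (auto simp: interprets_def)
qed

lemma inj_on_map: "inj_on f A \<Longrightarrow> inj_on (map f) (nlists n A)"
  by (rule inj_onI, erule map_inj_on, erule inj_on_subset) (simp add: nlists_def)

text \<open>A nonempty set determines the tuple length hidden in \<open>definable\<close>; the empty
  set does not and is treated separately.\<close>

lemma dfn_definable:
  assumes "univ M \<noteq> {}" "definable M X" "X \<subseteq> nlists m (univ M)"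
  shows "dfn M (\<lambda>e. map e [0..<m] \<in> X)"
proof (cases "X = {}")
  case True
  then show ?thesis using dfn_bool[OF assms(1), of False] by simp
next
  case False
  obtain n \<phi> p where p: "range p \<subseteq> univ M"
    and X: "X = {xs \<in> nlists n (univ M). sat M (\<lambda>i. if i < n then xs ! i else p i) \<phi>}"
    using assms(2) by (auto simp: definable_def)
  have n: "n = m" using False X assms(3) by (auto simp: nlists_def)
  let ?f = "\<lambda>i. if i < n then Inl i else Inr (p i)"
  have "dfn M (\<lambda>e. sat M (\<lambda>i. case ?f i of Inl j \<Rightarrow> e j | Inr c \<Rightarrow> c) \<phi>)"
  proof (rule dfn_rename[OF dfn_sat[OF assms(1)]])
    fix i c assume "?f i = Inr c"
    then show "c \<in> univ M" using p by (auto split: if_splits)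
  qed
  then show ?thesis
  proof (rule dfn_cong)
    fix e :: "nat \<Rightarrow> 'a" assume e: "range e \<subseteq> univ M"
    have "(\<lambda>i. case ?f i of Inl j \<Rightarrow> e j | Inr c \<Rightarrow> c) = (\<lambda>i. if i < n then map e [0..<m] ! i else p i)"
      by (auto simp: n)
    moreover have "map e [0..<m] \<in> nlists n (univ M)" using e n by (auto simp: nlists_def)
    ultimately show "map e [0..<m] \<in> X \<longleftrightarrow>
        sat M (\<lambda>i. case ?f i of Inl j \<Rightarrow> e j | Inr c \<Rightarrow> c) \<phi>"
      by (simp add: X)
  qed
qed

lemma definable_dfn:
  assumes "dfn M (\<lambda>e. P (map e [0..<m]))"
  shows "definable M {xs \<in> nlists m (univ M). P xs}"
proof -
  obtain \<phi> p where p: "range p \<subseteq> univ M"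
    and \<phi>: "\<And>e. range e \<subseteq> univ M \<Longrightarrow> P (map e [0..<m]) = sat M (mix e p) \<phi>"
    using assms by (auto simp: dfn_def)
  \<comment> \<open>Parameters move to the places \<open>m + i\<close> with \<open>i\<close> odd.
    Assignment variables beyond the tuple all read place \<open>m\<close>, where \<open>q\<close>
    has the value \<open>p 0\<close>.\<close>
  define f where "f i = (if odd i then m + i else if i div 2 < m then i div 2 else m)" for i
  define q where "q i = p ((i - m) div 2)" for i
  obtain \<phi>' where \<phi>': "\<And>e. sat M e \<phi>' = sat M (\<lambda>i. e (f i)) \<phi>" using ex_rename by blast
  have "P xs \<longleftrightarrow> sat M (\<lambda>i. if i < m then xs ! i else q i) \<phi>'" if xs: "xs \<in> nlists m (univ M)" for xs
  proof -
    let ?e = "\<lambda>i. if i < m then xs ! i else p 0"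
    have "map ?e [0..<m] = xs" using xs by (intro nth_equalityI) (auto simp: nlists_def)
    moreover have "range ?e \<subseteq> univ M" using xs p by (auto simp: nlists_def)
    moreover have "(\<lambda>i. (\<lambda>i. if i < m then xs ! i else q i) (f i)) = mix ?e p"
      by (auto simp: fun_eq_iff f_def q_def mix_def)
    ultimately show ?thesis using \<phi>[of ?e] by (simp add: \<phi>')
  qed
  then have "{xs \<in> nlists m (univ M). P xs} =
      {xs \<in> nlists m (univ M). sat M (\<lambda>i. if i < m then xs ! i else q i) \<phi>'}" by blast
  moreover have "range q \<subseteq> univ M" using p by (auto simp: q_def)
  ultimately show ?thesis unfolding definable_def by blast
qed

lemma dfn_ex_list:
  "dfn M (\<lambda>e. R (\<lambda>i. e (i + k)) (map e [0..<k])) \<Longrightarrow> dfn M (\<lambda>e. \<exists>xs\<in>nlists k (univ M). R e xs)"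
proof (induction k arbitrary: R)
  case 0
  then show ?case by (simp add: nlists_def)
next
  case (Suc k)
  \<comment> \<open>Peeling off the last component leaves the other components at variables
    \<open>0\<close> to \<open>k - 1\<close>, as the induction hypothesis expects.\<close>
  have "dfn M (\<lambda>e. \<exists>ys\<in>nlists k (univ M). R (\<lambda>i. e (Suc i)) (ys @ [e 0]))"
    by (rule Suc.IH) (use Suc.prems in simp)
  then have "dfn M (\<lambda>e. \<exists>x\<in>univ M. \<exists>ys\<in>nlists k (univ M). R e (ys @ [x]))"
    by (rule dfn_ex)
  moreover have "(\<exists>xs\<in>nlists (Suc k) (univ M). R e xs) \<longleftrightarrow>
      (\<exists>x\<in>univ M. \<exists>ys\<in>nlists k (univ M). R e (ys @ [x]))" for e
  proof
    assume "\<exists>xs\<in>nlists (Suc k) (univ M). R e xs"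
    then obtain xs where xs: "xs \<in> nlists (Suc k) (univ M)" "R e xs" by blast
    then obtain ys y where "xs = ys @ [y]" by (cases xs rule: rev_cases) (auto simp: nlists_def)
    then show "\<exists>x\<in>univ M. \<exists>ys\<in>nlists k (univ M). R e (ys @ [x])"
      using xs by (auto simp: nlists_def)
  next
    assume "\<exists>x\<in>univ M. \<exists>ys\<in>nlists k (univ M). R e (ys @ [x])"
    then obtain x ys where "x \<in> univ M" "ys \<in> nlists k (univ M)" "R e (ys @ [x])" by blast
    then show "\<exists>xs\<in>nlists (Suc k) (univ M). R e xs"
      by (intro bexI[of _ "ys @ [x]"]) (auto simp: nlists_def)
  qed
  ultimately show ?case by simp
qed

lemma length_concat_const:
  "\<forall>xs\<in>set xss. length xs = k \<Longrightarrow> length (concat xss) = length xss * k"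
  by (induction xss) simp_all

lemma take_drop_concat:
  "\<forall>xs\<in>set xss. length xs = k \<Longrightarrow> j < length xss \<Longrightarrow> take k (drop (j * k) (concat xss)) = xss ! j"
proof (induction xss arbitrary: j)
  case (Cons xs xss)
  then show ?case by (cases j) simp_all
qed simp

section \<open>Coding tuples by elements\<close>

fun code :: "(set_pred, 'a) struc \<Rightarrow> 'a list \<Rightarrow> 'a" where
  "code M [] = emp M"
| "code M (x # xs) = pr M x (code M xs)"

context zf_model
begin

lemma dfn_all_less [dfn_intros]: "(\<And>j :: nat. j < n \<Longrightarrow> dfn M (P j)) \<Longrightarrow> dfn M (\<lambda>e. \<forall>j<n. P j e)"
proof (induction n)
  case 0
  then show ?case by (simp add: dfn_const)
next
  case (Suc n)
  then have "dfn M (\<lambda>e. P n e \<and> (\<forall>j<n. P j e))" by (intro dfn_conj) auto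
  then show ?case by (simp add: All_less_Suc)
qed

lemma code_univ: "set xs \<subseteq> U \<Longrightarrow> code M xs \<in> U"
  by (induction xs) auto

lemma code_inj: "set xs \<subseteq> U \<Longrightarrow> set ys \<subseteq> U \<Longrightarrow> length xs = length ys \<Longrightarrow> code M xs = code M ys \<Longrightarrow> xs = ys"
proof (induction xs arbitrary: ys)
  case (Cons x xs)
  then obtain y ys' where "ys = y # ys'" by (cases ys) auto
  moreover from this have "x \<in> U" "y \<in> U" "set xs \<subseteq> U" "set ys' \<subseteq> U" "length xs = length ys'"
    using Cons.prems(1-3) by simp_all
  moreover from this have "code M xs \<in> U" "code M ys' \<in> U" by (simp_all add: code_univ)
  ultimately have "x = y" "code M xs = code M ys'" using Cons.prems(4) by simp_all
  with \<open>ys = y # ys'\<close> show ?case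
    using Cons.IH \<open>set xs \<subseteq> U\<close> \<open>set ys' \<subseteq> U\<close> \<open>length xs = length ys'\<close> by blast
qed simp

lemma inj_on_code: "A \<subseteq> nlists n U \<Longrightarrow> inj_on (code M) A"
  by (rule inj_onI) (rule code_inj, auto simp: nlists_def)

lemma tm_code [dfn_intros]: "tm M (\<lambda>e. code M (map e js))"
  by (induction js) (simp_all add: tm_emp tm_pr tm_var')

end

text \<open>\<open>L\<close> is an interpreted structure of \<open>k\<close>-tuples; its coded copy
  \<open>L'\<close> lives on elements of \<open>K\<close>, which makes the comparison of models
  applicable.\<close>

locale zf_interp = K: zf_model K
  for K :: "(set_pred, 'a) struc" and L :: "(set_pred, 'a list) struc" and k :: nat +
  assumes models_L: "models set_ar L ZF" and interp: "K \<unrhd>\<^sub>p\<^sub>a\<^sub>r L"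
    and L_nlists: "univ L \<subseteq> nlists k (univ K)"
begin

abbreviation L' :: "(set_pred, 'a) struc" where "L' \<equiv> push (code K) L"

lemma inj: "inj_on (code K) (univ L)"
  by (rule K.inj_on_code[OF L_nlists])

lemma struc_L: "is_struc set_ar L"
  using models_L by (simp add: models_def)

sublocale L: zf_model L'
  by unfold_locales (rule models_push[OF models_L inj])

lemma subset: "univ L' \<subseteq> univ K"
  using L_nlists by (auto simp: nlists_def intro!: K.code_univ)

lemma dfn_in_L: "dfn K (\<lambda>e. map e [0..<k] \<in> univ L)"
  using interp by (intro dfn_definable[OF _ _ L_nlists]) (auto simp: interprets_def)

lemma dfn_univ: "dfn1 K (\<lambda>x. x \<in> univ L')"
proof -
  have "dfn K (\<lambda>e. \<exists>xs\<in>nlists k (univ K). xs \<in> univ L \<and> e 0 = code K xs)"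
    by (rule dfn_ex_list) (intro dfn_conj dfn_in_L dfn_eq K.tm_code K.tm_var')
  moreover have "x \<in> univ L' \<longleftrightarrow> (\<exists>xs\<in>nlists k (univ K). xs \<in> univ L \<and> x = code K xs)" for x
    using L_nlists by auto
  ultimately show ?thesis by (simp add: dfn1_def)
qed

lemma dfn_mem: "dfn2 K (\<lambda>x y. x \<in>\<^bsub>L'\<^esub> y)"
proof -
  let ?Z = "concat ` rel L Mem"
  have rel: "rel L Mem \<subseteq> nlists 2 (univ L)" using struc_L by (simp add: is_struc_def set_ar_def)
  have mem: "\<exists>xs ys. zs = [xs, ys] \<and> xs \<in> univ L \<and> ys \<in> univ L" if "zs \<in> rel L Mem" for zs
    using rel that by (auto simp: nlists_def numeral_2_eq_2 length_Suc_conv)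
  have len: "length xs = k" "set xs \<subseteq> univ K" if "xs \<in> univ L" for xs
    using L_nlists that by (auto simp: nlists_def)
  have Z: "?Z \<subseteq> nlists (k + k) (univ K)"
  proof
    fix z assume "z \<in> ?Z"
    then obtain zs where zs: "zs \<in> rel L Mem" "z = concat zs" by blast
    from mem[OF zs(1)] obtain xs ys where xy: "zs = [xs, ys]" "xs \<in> univ L" "ys \<in> univ L" by blast
    then show "z \<in> nlists (k + k) (univ K)"
      using len[OF xy(2)] len[OF xy(3)] zs(2) by (simp add: nlists_def)
  qed
  have "dfn K (\<lambda>e. map e [0..<k + k] \<in> ?Z)"
    by (rule dfn_definable[OF _ _ Z]) (use interp in \<open>simp_all add: interprets_def\<close>)
  \<comment> \<open>Inside the two list quantifiers \<open>ys\<close> occupies the first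
    \<open>k\<close> variables and \<open>xs\<close> the next \<open>k\<close>, while
    \<open>?Z\<close> expects \<open>xs\<close> first.\<close>
  from dfn_rename_var[OF this, of "\<lambda>j. if j < k then j + k else j - k"]
  have dfn: "dfn K (\<lambda>e. map (\<lambda>j. e (j + k)) [0..<k] @ map e [0..<k] \<in> ?Z)"
  proof (rule dfn_cong)
    fix e :: "nat \<Rightarrow> 'a"
    have "map (\<lambda>j. e (j + k)) [0..<k] @ map e [0..<k] =
        map (\<lambda>i. e (if i < k then i + k else i - k)) [0..<k + k]"
      by (intro nth_equalityI) (auto simp: nth_append)
    then show "(map (\<lambda>j. e (j + k)) [0..<k] @ map e [0..<k] \<in> ?Z) =
        (map (\<lambda>i. e (if i < k then i + k else i - k)) [0..<k + k] \<in> ?Z)" by simp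
  qed
  have "dfn K (\<lambda>e. \<exists>xs\<in>nlists k (univ K). \<exists>ys\<in>nlists k (univ K).
      xs @ ys \<in> ?Z \<and> e 0 = code K xs \<and> e 1 = code K ys)"
  proof (intro dfn_ex_list dfn_conj)
    have code: "code K (map (\<lambda>i. e (i + k)) [0..<k]) = code K (map e (map (\<lambda>i. i + k) [0..<k]))" for e
      by (simp add: comp_def)
    show "dfn K (\<lambda>e. e (0 + k + k) = code K (map (\<lambda>i. e (i + k)) [0..<k]))"
      unfolding code by (intro dfn_eq K.tm_code K.tm_var')
  qed (use dfn in \<open>simp_all add: dfn_eq K.tm_code K.tm_var'\<close>)
  moreover have "x \<in>\<^bsub>L'\<^esub> y \<longleftrightarrow> (\<exists>xs\<in>nlists k (univ K). \<exists>ys\<in>nlists k (univ K).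
      xs @ ys \<in> ?Z \<and> x = code K xs \<and> y = code K ys)" for x y
  proof
    assume "x \<in>\<^bsub>L'\<^esub> y"
    then obtain zs where zs: "zs \<in> rel L Mem" "[x, y] = map (code K) zs"
      by (auto simp: mem_in_def push_def)
    from mem[OF zs(1)] obtain xs ys where xy: "zs = [xs, ys]" "xs \<in> univ L" "ys \<in> univ L" by blast
    then have "xs @ ys \<in> ?Z" using zs(1) by force
    then show "\<exists>xs\<in>nlists k (univ K). \<exists>ys\<in>nlists k (univ K).
      xs @ ys \<in> ?Z \<and> x = code K xs \<and> y = code K ys"
      using xy zs(2) L_nlists by auto
  next
    assume "\<exists>xs\<in>nlists k (univ K). \<exists>ys\<in>nlists k (univ K).
      xs @ ys \<in> ?Z \<and> x = code K xs \<and> y = code K ys"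
    then obtain xs ys zs where xy: "length xs = k" "zs \<in> rel L Mem" "xs @ ys = concat zs"
      "x = code K xs" "y = code K ys" by (auto simp: nlists_def)
    from mem[OF xy(2)] obtain xs' ys' where zs: "zs = [xs', ys']" "xs' \<in> univ L" by blast
    \<comment> \<open>The known length \<open>k\<close> of the first block makes the flattening
      reversible.\<close>
    then have "zs = [xs, ys]" using xy(1,3) len(1)[OF zs(2)] by simp
    then have "[x, y] = map (code K) zs" using xy(4,5) by simp
    with xy(2) show "x \<in>\<^bsub>L'\<^esub> y" by (auto simp: mem_in_def push_def)
  qed
  ultimately show ?thesis by (simp add: dfn2_def)
qed

text \<open>Relativisation: quantifiers over \<open>L'\<close> become quantifiers over
  \<open>K\<close> restricted to the definable universe of \<open>L'\<close>. Atoms of wrong length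
  are constantly false.\<close>

lemma dfn_sat_L: "dfn K (\<lambda>e. sat L' e \<phi>)"
proof (induction \<phi>)
  case (Eq x y)
  show ?case by (simp add: dfn_eq K.tm_var')
next
  case (Atom R xs)
  show ?case
  proof (cases "length xs = 2")
    case True
    then obtain a b where xs: "xs = [a, b]" by (auto simp: numeral_2_eq_2 length_Suc_conv)
    have "dfn K (\<lambda>e. e a \<in>\<^bsub>L'\<^esub> e b)" by (intro dfn2_app[OF dfn_mem] K.tm_var')
    then show ?thesis by (cases R) (simp add: xs mem_in_def)
  next
    case False
    have "is_struc set_ar L'" using L.models by (simp add: models_def)
    then have "map e xs \<notin> rel L' R" for e
      using nlistsE_length[OF rel_nlists[of set_ar L' "map e xs" R]] False by (auto simp: set_ar_def)
    then show ?thesis by (simp add: K.dfn_const)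
  qed
next
  case (Exists x \<phi>)
  have "(\<lambda>i. e (Suc i))(x := e 0) = (\<lambda>i. e (if i = x then 0 else Suc i))" for e :: "nat \<Rightarrow> 'a"
    by auto
  then have "dfn K (\<lambda>e. sat L' ((\<lambda>i. e (Suc i))(x := e 0)) \<phi>)"
    using dfn_rename_var[OF Exists.IH, of "\<lambda>i. if i = x then 0 else Suc i"] by simp
  then have "dfn K (\<lambda>e. \<exists>a\<in>univ K. a \<in> univ L' \<and> sat L' (e(x := a)) \<phi>)"
    by (intro dfn_ex dfn_conj dfn1_app[OF dfn_univ] K.tm_var')
  moreover have "sat L' e (Exists x \<phi>) \<longleftrightarrow> (\<exists>a\<in>univ K. a \<in> univ L' \<and> sat L' (e(x := a)) \<phi>)" for e
    using subset by auto
  ultimately show ?case by simp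
qed (simp_all add: dfn_neg dfn_conj)

lemma dfn_transfer:
  assumes "dfn L' P"
  shows "\<exists>P'. dfn K P' \<and> (\<forall>e. range e \<subseteq> univ L' \<longrightarrow> P' e = P e)"
proof -
  obtain \<phi> p where p: "range p \<subseteq> univ L'"
    and \<phi>: "\<And>e. range e \<subseteq> univ L' \<Longrightarrow> P e = sat L' (mix e p) \<phi>"
    using assms by (auto simp: dfn_def)
  let ?f = "\<lambda>i. if even i then Inl (i div 2) else Inr (p (i div 2))"
  have "dfn K (\<lambda>e. sat L' (\<lambda>i. case ?f i of Inl j \<Rightarrow> e j | Inr c \<Rightarrow> c) \<phi>)"
  proof (rule dfn_rename[OF dfn_sat_L])
    fix i c assume "?f i = Inr c"
    then show "c \<in> univ K" using p subset by (auto split: if_splits)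
  qed
  moreover have "(\<lambda>i. case ?f i of Inl j \<Rightarrow> e j | Inr c \<Rightarrow> c) = mix e p" for e
    by (auto simp: mix_def)
  ultimately show ?thesis by (intro exI[of _ "\<lambda>e. sat L' (mix e p) \<phi>"]) (simp add: \<phi>)
qed

sublocale zf_pair K L'
proof
  fix R assume "dfn2 L' R"
  from dfn_transfer[OF this[unfolded dfn2_def]] obtain P' where
    P': "dfn K P'" "\<forall>e. range e \<subseteq> univ L' \<longrightarrow> P' e = R (e 0) (e 1)" by blast
  \<comment> \<open>Every variable other than \<open>0\<close> is made to read variable
    \<open>1\<close>, so the whole assignment lies in \<open>L'\<close> and the transferred
    predicate agrees with \<open>R\<close>.\<close>
  have dfnP: "dfn K (\<lambda>e. e 0 \<in> univ L' \<and> e 1 \<in> univ L' \<and> P' (\<lambda>i. e (if i = 0 then 0 else 1)))"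
    by (intro dfn_conj dfn1_app[OF dfn_univ] K.tm_var' dfn_rename_var[OF P'(1)])
  have eqP: "P' (\<lambda>i. e (if i = 0 then 0 else 1)) = R (e 0) (e 1)"
    if "e 0 \<in> univ L'" "e 1 \<in> univ L'" for e :: "nat \<Rightarrow> 'a"
  proof -
    have "range (\<lambda>i. e (if i = 0 then 0 else 1)) \<subseteq> univ L'" using that by auto
    from P'(2)[rule_format, OF this] show ?thesis by simp
  qed
  show "dfn2 K (\<lambda>x y. x \<in> univ L' \<and> y \<in> univ L' \<and> R x y)"
    unfolding dfn2_def by (rule dfn_cong[OF dfnP]) (use eqP in blast)
qed (rule subset)

text \<open>The given graph contains the flattened value \<open>zs\<close>. Its \<open>l\<close>
  blocks of length \<open>k\<close> are coded in \<open>K\<close>, giving \<open>ws\<close>, and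
  \<open>ws\<close> is coded in \<open>L'\<close>; the latter coding is definable in
  \<open>K\<close> by transfer.\<close>

lemma dfn_iso_graph:
  fixes l :: nat
  assumes i0: "\<And>x. x \<in> univ K \<Longrightarrow> i0 x \<in> nlists l (univ L)"
    and graph: "definable K ((\<lambda>x. x # concat (i0 x)) ` univ K)"
  shows "dfn2 K (\<lambda>x y. y = code L' (map (code K) (i0 x)))"
proof -
  let ?G = "(\<lambda>x. x # concat (i0 x)) ` univ K"
  let ?n = "l * k"
  have len: "length (i0 x) = l" "\<forall>xs\<in>set (i0 x). length xs = k \<and> set xs \<subseteq> univ K \<and> xs \<in> univ L"
    if "x \<in> univ K" for x
    using i0[OF that] L_nlists by (auto simp: nlists_def)
  have lenc: "length (concat (i0 x)) = ?n" if "x \<in> univ K" for x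
    using length_concat_const[of "i0 x" k] len[OF that] by simp
  have setc: "set (concat (i0 x)) \<subseteq> univ K" if "x \<in> univ K" for x
    using len(2)[OF that] by auto
  have G: "?G \<subseteq> nlists (Suc ?n) (univ K)"
  proof
    fix zs assume "zs \<in> ?G"
    then obtain x where "x \<in> univ K" "zs = x # concat (i0 x)" by blast
    with lenc[of x] setc[of x] show "zs \<in> nlists (Suc ?n) (univ K)" by (simp add: nlists_def)
  qed
  have "dfn L' (\<lambda>e. e 0 = code L' (map e (map Suc [0..<l])))"
    by (intro dfn_eq L.tm_code L.tm_var')
  from dfn_transfer[OF this] obtain Q where Q: "dfn K Q"
    "\<And>e. range e \<subseteq> univ L' \<Longrightarrow> Q e \<longleftrightarrow> e 0 = code L' (map e (map Suc [0..<l]))" by blast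
  \<comment> \<open>\<open>y\<close> is at place \<open>0\<close> and \<open>ws\<close> at places
    \<open>1\<close> to \<open>l\<close>; filling up with \<open>y\<close> keeps the assignment
    inside \<open>L'\<close>.\<close>
  let ?env = "\<lambda>y ws i. if i = 0 \<or> \<not> i - 1 < l then y else ws ! (i - 1)"
  let ?R = "\<lambda>x y zs ws. x # zs \<in> ?G \<and> (\<forall>j<l. ws ! j = code K (take k (drop (j * k) zs))) \<and>
    (\<forall>j<l. ws ! j \<in> univ L') \<and> y \<in> univ L' \<and> Q (?env y ws)"
  have dfnR: "dfn K (\<lambda>e. \<exists>zs\<in>nlists ?n (univ K). \<exists>ws\<in>nlists l (univ K). ?R (e 0) (e 1) zs ws)"
  proof (intro dfn_ex_list dfn_conj K.dfn_all_less)
    have "dfn K (\<lambda>e. map e [0..<Suc ?n] \<in> ?G)"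
      by (rule dfn_definable[OF _ graph G]) simp
    \<comment> \<open>After both list quantifiers \<open>ws\<close> occupies the first
      \<open>l\<close> variables and \<open>zs\<close> the next \<open>?n\<close>, followed by
      \<open>x\<close> and \<open>y\<close>.\<close>
    from dfn_rename_var[OF this, of "\<lambda>i. if i = 0 then 0 + ?n + l else i - 1 + l"]
    show "dfn K (\<lambda>e. e (0 + ?n + l) # map (\<lambda>i. e (i + l)) [0..<?n] \<in> ?G)"
      by (simp add: upt_conv_Cons map_Suc_upt[symmetric] comp_def add.commute del: upt_Suc)
  next
    fix j assume j: "j < l"
    have "dfn K (\<lambda>e. e j = code K (map e (map (\<lambda>i. i + l) (take k (drop (j * k) [0..<?n])))))"
      by (intro dfn_eq K.tm_code K.tm_var')
    then show "dfn K (\<lambda>e. map e [0..<l] ! j =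
        code K (take k (drop (j * k) (map (\<lambda>i. e (i + l)) [0..<?n]))))"
      by (rule dfn_cong) (use j in \<open>simp add: take_map drop_map comp_def\<close>)
    have "dfn K (\<lambda>e. e j \<in> univ L')" by (intro dfn1_app[OF dfn_univ] K.tm_var')
    then show "dfn K (\<lambda>e. map e [0..<l] ! j \<in> univ L')"
      by (rule dfn_cong) (use j in simp)
  next
    show "dfn K (\<lambda>e. e (1 + ?n + l) \<in> univ L')" by (intro dfn1_app[OF dfn_univ] K.tm_var')
    have "?env (e (1 + ?n + l)) (map e [0..<l]) =
        (\<lambda>i. e (if i = 0 \<or> \<not> i - 1 < l then 1 + ?n + l else i - 1))" for e :: "nat \<Rightarrow> 'a"
      by (auto simp: fun_eq_iff)
    then show "dfn K (\<lambda>e. Q (?env (e (1 + ?n + l)) (map e [0..<l])))"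
      using dfn_rename_var[OF Q(1)] by simp
  qed
  have equiv: "y = code L' (map (code K) (i0 x)) \<longleftrightarrow>
      (\<exists>zs\<in>nlists ?n (univ K). \<exists>ws\<in>nlists l (univ K). ?R x y zs ws)"
    if x: "x \<in> univ K" for x y
  proof -
    let ?ws = "map (code K) (i0 x)"
    have ws: "set ?ws \<subseteq> univ L'" using i0[OF x] by (auto simp: nlists_def)
    have block: "take k (drop (j * k) (concat (i0 x))) = i0 x ! j" if "j < l" for j
      using take_drop_concat[of "i0 x" k j] len[OF x] that by simp
    have Qenv: "Q (?env y ws) \<longleftrightarrow> y = code L' ws"
      if "y \<in> univ L'" "set ws \<subseteq> univ L'" "length ws = l" for ws
    proof -
      have "range (?env y ws) \<subseteq> univ L'" using that by (auto simp: subset_iff)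
      moreover have "map (?env y ws) (map Suc [0..<l]) = ws"
        using that(3) by (intro nth_equalityI) auto
      ultimately show ?thesis using Q(2)[of "?env y ws"] by simp
    qed
    show ?thesis
    proof
      assume y: "y = code L' ?ws"
      then have yL: "y \<in> univ L'" using L.code_univ[OF ws] by simp
      have "?R x y (concat (i0 x)) ?ws"
        using x yL block ws len(1)[OF x] Qenv[OF yL ws] y by (auto simp: subset_iff)
      moreover have "concat (i0 x) \<in> nlists ?n (univ K)" "?ws \<in> nlists l (univ K)"
        using lenc[OF x] setc[OF x] len(1)[OF x] ws subset unfolding nlists_def by auto
      ultimately show "\<exists>zs\<in>nlists ?n (univ K). \<exists>ws\<in>nlists l (univ K). ?R x y zs ws" by blast
    next
      assume "\<exists>zs\<in>nlists ?n (univ K). \<exists>ws\<in>nlists l (univ K). ?R x y zs ws"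
      then obtain zs ws where R: "?R x y zs ws" and l: "length ws = l" by (auto simp: nlists_def)
      have zs: "zs = concat (i0 x)" using R by auto
      have "ws = ?ws" using R block len(1)[OF x] l unfolding zs by (intro nth_equalityI) auto
      moreover have "Q (?env y ws)" "y \<in> univ L'" using R by blast+
      ultimately show "y = code L' ?ws" using Qenv[of ws] ws l by metis
    qed
  qed
  show ?thesis
    unfolding dfn2_def
  proof (rule dfn_cong[OF dfnR])
    fix e :: "nat \<Rightarrow> 'a" assume "range e \<subseteq> univ K"
    then have "e 0 \<in> univ K" by auto
    then show "e 1 = code L' (map (code K) (i0 (e 0))) \<longleftrightarrow>
        (\<exists>zs\<in>nlists ?n (univ K). \<exists>ws\<in>nlists l (univ K). ?R (e 0) (e 1) zs ws)"
      by (rule equiv)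
  qed
qed

end

section \<open>Reduction of tuple structures to structures on elements of \<open>M\<close>\<close>

theorem theorem2p6:
  shows "solid TYPE('a) set_ar ZF"
  unfolding solid_def
proof (intro allI impI, elim conjE exE)
  fix M :: "(set_pred, 'a) struc" and M' :: "(set_pred, 'a list list) struc"
    and N :: "(set_pred, 'a list) struc" and i0
  assume M: "models set_ar M ZF" and M': "models set_ar M' ZF" and N: "models set_ar N ZF"
    and MN: "M \<unrhd>\<^sub>p\<^sub>a\<^sub>r N" and NM': "N \<unrhd>\<^sub>p\<^sub>a\<^sub>r M'"
    and iso: "isomorphism set_ar M M' i0"
    and graph: "definable M ((\<lambda>x. x # concat (i0 x)) ` univ M)"
  obtain k where k: "univ N \<subseteq> nlists k (univ M)"
    using MN definable_subset[of M "univ N"] unfolding interprets_def by blast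
  obtain l where l: "univ M' \<subseteq> nlists l (univ N)"
    using NM' definable_subset[of N "univ M'"] unfolding interprets_def by blast
  interpret MN: zf_interp M N k
    by unfold_locales (fact M N MN k)+
  let ?N = "push (code M) N"
  \<comment> \<open>Coding in two stages: coding the inner tuples in \<open>M\<close> turns elements
    of \<open>M'\<close> into tuples over \<open>?N\<close>; these are later coded in
    \<open>?N\<close>.\<close>
  let ?M' = "push (map (code M)) M'"
  have inj_map: "inj_on (map (code M)) (univ M')"
    using inj_on_map[OF MN.inj] l by (rule inj_on_subset)
  interpret NP: zf_interp ?N ?M' l
  proof
    show "models set_ar ?M' ZF" by (rule models_push[OF M' inj_map])
    show "?N \<unrhd>\<^sub>p\<^sub>a\<^sub>r ?M'" by (rule interprets_push[OF MN.struc_L MN.inj NM'])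
    show "univ ?M' \<subseteq> nlists l (univ ?N)"
    proof
      fix ws assume "ws \<in> univ ?M'"
      then obtain xss where "xss \<in> univ M'" "ws = map (code M) xss" by auto
      moreover from this have "xss \<in> nlists l (univ N)" using l by blast
      ultimately show "ws \<in> nlists l (univ ?N)" by (simp add: nlists_def image_mono)
    qed
  qed
  let ?P = "push (code ?N) ?M'"
  let ?i = "\<lambda>x. code ?N (map (code M) (i0 x))"
  have st: "is_struc set_ar M" "is_struc set_ar M'" using M M' by (simp_all add: models_def)
  have bij0: "bij_betw i0 (univ M) (univ M')" using iso by (simp add: isomorphism_def)
  have i0: "i0 x \<in> univ M'" if "x \<in> univ M" for x using bij0 that by (auto simp: bij_betw_def)
  interpret zf_solid M ?N ?P ?i
  proof
    show "bij_betw ?i (univ M) (univ ?P)"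
      using bij_betw_trans[OF bij0 bij_betw_trans[OF bij_push[OF inj_map] bij_push[OF NP.inj]]]
      by (simp add: comp_def)
  next
    fix R and xs :: "'a list" assume xs: "set xs \<subseteq> univ M"
    have set0: "set (map i0 xs) \<subseteq> univ M'" using xs i0 by auto
    have "map i0 xs \<in> rel M' R \<longleftrightarrow> xs \<in> rel M R"
    \<comment> \<open>\<open>isomorphism\<close> speaks only of lists of the right length; other
      lists belong to no relation of either structure.\<close>
    proof (cases "length xs = set_ar R")
      case True
      then have "xs \<in> nlists (set_ar R) (univ M)" using xs by (simp add: nlists_def)
      then show ?thesis using iso by (simp add: isomorphism_def)
    next
      case False
      then have "xs \<notin> rel M R" "map i0 xs \<notin> rel M' R"
        using nlistsE_length[OF rel_nlists[OF st(1)]] nlistsE_length[OF rel_nlists[OF st(2)]]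
        by (metis, metis length_map)
      then show ?thesis by simp
    qed
    moreover have "map (map (code M)) (map i0 xs) \<in> rel ?M' R \<longleftrightarrow> map i0 xs \<in> rel M' R"
      by (rule rel_push[OF st(2) inj_map set0])
    moreover have "map (code ?N) (map (map (code M)) (map i0 xs)) \<in> rel ?P R \<longleftrightarrow>
        map (map (code M)) (map i0 xs) \<in> rel ?M' R"
      by (rule rel_push[OF NP.struc_L NP.inj]) (use set0 in auto)
    ultimately show "map ?i xs \<in> rel ?P R \<longleftrightarrow> xs \<in> rel M R" by (simp add: comp_def)
  next
    show "dfn2 M (\<lambda>x y. y = ?i x)"
      by (rule MN.dfn_iso_graph[OF _ graph]) (use i0 l in blast)
  qed
  obtain t where t: "bij_betw t (univ M) (univ ?N)"
    "\<And>x y. x \<in> univ M \<Longrightarrow> y \<in> univ M \<Longrightarrow> x \<in>\<^bsub>M\<^esub> y \<longleftrightarrow> t x \<in>\<^bsub>?N\<^esub> t y"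
    "dfn2 M (\<lambda>x y. x \<in> univ M \<and> y = t x)"
    using ex_definable_isomorphism by blast
  \<comment> \<open>The isomorphism reaches the coded copy; decoding its values returns to the
    tuples of \<open>N\<close>.\<close>
  let ?f = "\<lambda>x. inv_into (univ N) (code M) (t x)"
  have tN: "t x \<in> code M ` univ N" if "x \<in> univ M" for x
    using t(1) that by (auto simp: bij_betw_def)
  have f: "?f x \<in> univ N" "code M (?f x) = t x" if "x \<in> univ M" for x
    using tN[OF that] by (auto simp: inv_into_into f_inv_into_f)
  have "isomorphism set_ar M N ?f"
    unfolding isomorphism_def
  proof (intro conjI allI ballI)
    show "bij_betw ?f (univ M) (univ N)"
      using bij_betw_trans[OF t(1) bij_betw_inv_into[OF bij_push[OF MN.inj]]] by (simp add: comp_def)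
  next
    fix R xs assume "xs \<in> nlists (set_ar R) (univ M)"
    then obtain a b where xs: "xs = [a, b]" "a \<in> univ M" "b \<in> univ M"
      by (auto simp: nlists_def set_ar_def numeral_2_eq_2 length_Suc_conv)
    have "[t a, t b] \<in> rel ?N Mem \<longleftrightarrow> [?f a, ?f b] \<in> rel N Mem"
      using rel_push[OF MN.struc_L MN.inj, of "[?f a, ?f b]" Mem] f xs(2,3) by simp
    then show "xs \<in> rel M R \<longleftrightarrow> map ?f xs \<in> rel N R"
      using t(2)[OF xs(2,3)] by (cases R) (simp add: xs(1) mem_in_def)
  qed
  moreover have "definable M ((\<lambda>x. x # ?f x) ` univ M)"
  proof -
    \<comment> \<open>The graph is described without decoding, by comparing the code of the tuple
      with \<open>t\<close>.\<close>
    let ?Q = "\<lambda>xs. tl xs \<in> univ N \<and> hd xs \<in> univ M \<and> code M (tl xs) = t (hd xs)"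
    have "dfn M (\<lambda>e. map e (map Suc [0..<k]) \<in> univ N \<and>
        (e 0 \<in> univ M \<and> code M (map e (map Suc [0..<k])) = t (e 0)))"
    proof (rule dfn_conj)
      show "dfn M (\<lambda>e. map e (map Suc [0..<k]) \<in> univ N)"
        using dfn_rename_var[OF MN.dfn_in_L, of Suc] by (simp add: comp_def)
      show "dfn M (\<lambda>e. e 0 \<in> univ M \<and> code M (map e (map Suc [0..<k])) = t (e 0))"
        by (rule dfn2_app[OF t(3), of "\<lambda>e. e 0"]) (intro MN.K.tm_var' MN.K.tm_code)+
    qed
    then have "dfn M (\<lambda>e. ?Q (map e [0..<Suc k]))"
      by (simp add: upt_conv_Cons map_Suc_upt[symmetric] comp_def del: upt_Suc)
    then have "definable M {xs \<in> nlists (Suc k) (univ M). ?Q xs}" by (rule definable_dfn)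
    moreover have "{xs \<in> nlists (Suc k) (univ M). ?Q xs} = (\<lambda>x. x # ?f x) ` univ M"
    proof (intro equalityI subsetI)
      fix xs assume "xs \<in> {xs \<in> nlists (Suc k) (univ M). ?Q xs}"
      then obtain x ys where x: "xs = x # ys" "x \<in> univ M" "ys \<in> univ N" "code M ys = t x"
        by (auto simp: nlists_def length_Suc_conv)
      then have "?f x = ys" using inv_into_f_f[OF MN.inj x(3)] by simp
      with x(1,2) show "xs \<in> (\<lambda>x. x # ?f x) ` univ M" by blast
    next
      fix xs assume "xs \<in> (\<lambda>x. x # ?f x) ` univ M"
      then obtain x where x: "x \<in> univ M" "xs = x # ?f x" by blast
      moreover have "?f x \<in> nlists k (univ M)" using f(1)[OF x(1)] k by blast
      ultimately show "xs \<in> {xs \<in> nlists (Suc k) (univ M). ?Q xs}"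
        using f[OF x(1)] by (simp add: nlists_def)
    qed
    ultimately show ?thesis by simp
  qed
  ultimately show "\<exists>i. isomorphism set_ar M N i \<and> definable M ((\<lambda>x. x # i x) ` univ M)" by blast
qed

end
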